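(* Let $d,T\ge 1$ be integers and $1\le p<\infty$. Let $\xi\in\mathcal P_p((\mathbb R^d)^T)$ be a noise distribution satisfying: (i) $\xi$ has a continuously differentiable density $f:(\mathbb R^d)^T\to\mathbb R$ with $\nabla f\in L^1((\mathbb R^d)^T;(\mathbb R^d)^T)$; (ii) the set of real zeros of $\widehat f$ has Lebesgue measure zero. Let $\mu,\nu\in\mathcal P_p((\mathbb R^d)^T)$. Then for any $R>0$ and $\sigma>0$, $$\mathcal{AW}^{(\sigma)}_p(\mu,\nu)^p\le 6^{p-1}T2^T\left(R^p\,\|\nabla f\|_{L^1}\frac{\mathcal W_1(\mu,\nu)}{\sigma}+\int_{\{|x|\ge R\}}|x|^p\,(\mu^\sigma+\nu^\sigma)(dx)\right).$$
   Context: $|\cdot|$ is the Euclidean norm. $\mathcal P_p(\mathbb R^N)$ is the set of Borel probability measures on $\mathbb R^N$ with finite $p$-th moment. $\mathcal W_p(\mu,\nu)=(\inf_{\pi\in\mathrm{Cpl}(\mu,\nu)}\int|x-y|^p\,d\pi)^{1/p}$, where $\mathrm{Cpl}(\mu,\nu)$ is the set of couplings. For $x\in(\mathbb R^d)^T$, $x_t\in\mathbb R^d$ is the $t$-th coordinate and $x_{1:t}=(x_1,\dots,x_t)$. A coupling $\pi$ of $\mu,\nu\in\mathcal P((\mathbb R^d)^T)$ is bicausal if for $(X,Y)\sim\pi$ and every $t\in\{1,\dots,T-1\}$: $Y_{1:t}$ and $(X_{t+1},\dots,X_T)$ are conditionally independent given $X_{1:t}$, and $X_{1:t}$ and $(Y_{t+1},\dots,Y_T)$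 are conditionally independent given $Y_{1:t}$; $\mathrm{Cpl}_{bc}(\mu,\nu)$ is the set of bicausal couplings. The adapted Wasserstein distance is $\mathcal{AW}_p(\mu,\nu)=\left(\inf_{\pi\in\mathrm{Cpl}_{bc}(\mu,\nu)}\int\sum_{t=1}^T|x_t-y_t|^p\,\pi(dx,dy)\right)^{1/p}$. For $\sigma>0$, $\xi_\sigma$ is the law of $\sigma Z$ with $Z\sim\xi$; $\mu^\sigma:=\mu\ast\xi_\sigma$; $\mathcal{AW}^{(\sigma)}_p(\mu,\nu):=\mathcal{AW}_p(\mu^\sigma,\nu^\sigma)$. Fourier transform: $\widehat f(s)=\int e^{-2\pi i s\cdot x}f(x)\,dx$. $\|\nabla f\|_{L^1}=\int|\nabla f(x)|\,dx$. *)

theory Defs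
  imports "HOL-Probability.Probability"
begin

text \<open>
  The path space \<open>(\<real>\<^sup>d)\<^sup>T\<close> is \<open>real ^ 'd ^ 't\<close>, where \<open>'t :: {finite, linorder}\<close> is the set of times:
  it is order-isomorphic to \<open>{1, \<dots>, T}\<close> for \<open>T = CARD('t)\<close>, its last element \<open>Max UNIV\<close> plays the role
  of \<open>T\<close>, and \<open>x $ s\<close> is the \<open>s\<close>-th coordinate of the path \<open>x\<close>. The norms of \<open>real ^ 'd\<close> and
  \<open>real ^ 'd ^ 't\<close> are the Euclidean ones.
\<close>

type_synonym ('d, 't) path_space = "((real, 'd) vec, 't) vec"

text \<open>
  Transport costs take values in \<open>[0, \<infinity>]\<close>, so that no convention for infinite costs is needed.
  The power below is meant for exponents \<open>a > 0\<close> only.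
\<close>

definition epowr :: "ennreal \<Rightarrow> real \<Rightarrow> ennreal" where
  "epowr x a = (if x = \<top> then \<top> else ennreal (enn2real x powr a))"

definition prob_measures_p :: "real \<Rightarrow> 'a::euclidean_space measure set" where
  "prob_measures_p p =
     {\<mu>. prob_space \<mu> \<and> sets \<mu> = sets borel \<and> integrable \<mu> (\<lambda>x. norm x powr p)}"

definition couplings :: "'a::euclidean_space measure \<Rightarrow> 'a measure \<Rightarrow> ('a \<times> 'a) measure set" where
  "couplings \<mu> \<nu> =
     {\<pi>. prob_space \<pi> \<and> sets \<pi> = sets (borel \<Otimes>\<^sub>M borel) \<and>
         distr \<pi> borel fst = \<mu> \<and> distr \<pi> borel snd = \<nu>}"

definition wasserstein :: "real \<Rightarrow> 'a::euclidean_space measure \<Rightarrow> 'a measure \<Rightarrow> ennreal" where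
  "wasserstein p \<mu> \<nu> =
     epowr (INF \<pi>\<in>couplings \<mu> \<nu>. \<integral>\<^sup>+ (x, y). ennreal (norm (x - y) powr p) \<partial>\<pi>) (1 / p)"

text \<open>
  Conditional independence of the random variables \<open>A\<close> and \<open>B\<close> given the random variable \<open>C\<close>. The
  measurability conditions are part of the definition because \<^const>\<open>real_cond_exp\<close> is \<open>0\<close> when its
  second argument is not a sub-\<open>\<sigma>\<close>-algebra.
\<close>

definition (in prob_space) cond_indep_var ::
  "'b measure \<Rightarrow> ('a \<Rightarrow> 'b) \<Rightarrow> 'c measure \<Rightarrow> ('a \<Rightarrow> 'c) \<Rightarrow> 'd measure \<Rightarrow> ('a \<Rightarrow> 'd) \<Rightarrow> bool" where
  "cond_indep_var Ma A Mb B Mc C \<longleftrightarrow>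
     random_variable Ma A \<and> random_variable Mb B \<and> random_variable Mc C \<and>
     (\<forall>U\<in>sets Ma. \<forall>V\<in>sets Mb.
        let E = real_cond_exp M (vimage_algebra (space M) C Mc) in
        AE \<omega> in M. E (\<lambda>\<omega>. indicator U (A \<omega>) * indicator V (B \<omega>)) \<omega> =
                   E (\<lambda>\<omega>. indicator U (A \<omega>)) \<omega> * E (\<lambda>\<omega>. indicator V (B \<omega>)) \<omega>)"

text \<open>The tuple of coordinates \<open>(x\<^sub>s)\<close> for \<open>s \<in> I\<close>: \<open>x\<^bsub>1:t\<^esub>\<close> is \<open>coords {..t} x\<close>.\<close>

definition coords :: "'t set \<Rightarrow> real ^ 'd ^ 't::finite \<Rightarrow> 't \<Rightarrow> real ^ 'd::finite" where
  "coords I x = (\<lambda>s\<in>I. x $ s)"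

definition coords_algebra :: "'t set \<Rightarrow> ('t \<Rightarrow> real ^ 'd::finite) measure" where
  "coords_algebra I = (\<Pi>\<^sub>M s\<in>I. borel)"

lemma measurable_coords: "coords I \<in> borel \<rightarrow>\<^sub>M coords_algebra I"
  unfolding coords_def[abs_def] coords_algebra_def
  by (intro measurable_restrict borel_measurable_continuous_onI continuous_intros)

definition bicausal_couplings ::
  "('d::finite, 't::{finite, linorder}) path_space measure \<Rightarrow> ('d, 't) path_space measure \<Rightarrow>
   (('d, 't) path_space \<times> ('d, 't) path_space) measure set" where
  "bicausal_couplings \<mu> \<nu> =
     {\<pi> \<in> couplings \<mu> \<nu>. \<forall>t < Max UNIV.
        prob_space.cond_indep_var \<pi>
          (coords_algebra {..t}) (\<lambda>(x, y). coords {..t} y)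
          (coords_algebra {t<..}) (\<lambda>(x, y). coords {t<..} x)
          (coords_algebra {..t}) (\<lambda>(x, y). coords {..t} x) \<and>
        prob_space.cond_indep_var \<pi>
          (coords_algebra {..t}) (\<lambda>(x, y). coords {..t} x)
          (coords_algebra {t<..}) (\<lambda>(x, y). coords {t<..} y)
          (coords_algebra {..t}) (\<lambda>(x, y). coords {..t} y)}"

definition adapted_wasserstein ::
  "real \<Rightarrow> ('d::finite, 't::{finite, linorder}) path_space measure \<Rightarrow> ('d, 't) path_space measure \<Rightarrow> ennreal" where
  "adapted_wasserstein p \<mu> \<nu> =
     epowr (INF \<pi>\<in>bicausal_couplings \<mu> \<nu>.
              \<integral>\<^sup>+ (x, y). ennreal (\<Sum>t\<in>UNIV. norm (x $ t - y $ t) powr p) \<partial>\<pi>) (1 / p)"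

definition scaled_noise :: "'a::euclidean_space measure \<Rightarrow> real \<Rightarrow> 'a measure" where
  "scaled_noise \<xi> \<sigma> = distr \<xi> borel (\<lambda>z. \<sigma> *\<^sub>R z)"

definition smoothed ::
  "'a::ordered_euclidean_space measure \<Rightarrow> real \<Rightarrow> 'a measure \<Rightarrow> 'a measure" where
  "smoothed \<xi> \<sigma> \<mu> = (\<mu> \<star> scaled_noise \<xi> \<sigma>)"

definition smoothed_adapted_wasserstein ::
  "real \<Rightarrow> ('d, 't) path_space measure \<Rightarrow> real \<Rightarrow>
   ('d::finite, 't::{finite, linorder}) path_space measure \<Rightarrow> ('d, 't) path_space measure \<Rightarrow> ennreal" where
  "smoothed_adapted_wasserstein p \<xi> \<sigma> \<mu> \<nu> =
     adapted_wasserstein p (smoothed \<xi> \<sigma> \<mu>) (smoothed \<xi> \<sigma> \<nu>)"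

definition fourier :: "('a::euclidean_space \<Rightarrow> real) \<Rightarrow> 'a \<Rightarrow> complex" where
  "fourier f s = (LINT x|lborel. exp (- 2 * of_real pi * \<i> * of_real (s \<bullet> x)) * of_real (f x))"

end

theory Submission
  imports Defs
begin

text \<open>
  Let \<open>g\<close> and \<open>h\<close> be the densities of the two smoothed measures. Couple the paths one coordinate at a
  time, each time with a maximal coupling of the two conditional laws given the respective pasts.
  Each conditional law depends only on its own past, so the coupling is bicausal. Separation of the
  paths at time \<open>t\<close> has probability at most \<open>\<integral> g\<^sub><\<^sub>t \<delta>\<^sub>t\<close>, where \<open>\<delta>\<^sub>t\<close> is the total variation distance
  of the two conditional laws given the same past, and comparing both \<open>g\<^sub>\<le>\<^sub>t\<close> and \<open>g\<^sub><\<^sub>t\<close> with the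
  marginals of \<open>h\<close> bounds this by \<open>\<integral> \<bar>g - h\<bar>\<close>. Hence the paths differ with probability at most
  \<open>T \<integral> \<bar>g - h\<bar>\<close>. On that event the cost is bounded by \<open>\<bar>x\<bar>\<^sup>p\<close> and \<open>\<bar>y\<bar>\<^sup>p\<close>, which are split according to
  whether the norm exceeds \<open>R\<close>, and \<open>2 T \<le> 2\<^sup>T\<close>. Finally, \<open>\<integral> \<bar>g - h\<bar>\<close> is at most \<open>\<parallel>\<nabla>f\<parallel> / \<sigma>\<close> times the first
  Wasserstein distance because \<open>\<integral> \<bar>f (z + v) - f z\<bar> dz \<le> \<bar>v\<bar> \<parallel>\<nabla>f\<parallel>\<close>.
\<close>

section \<open>Kernels as operators on nonnegative functions\<close>

text \<open>Conditional laws can jump when the past moves slightly, so closeness in the first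
  Wasserstein distance says nothing about them. Smoothing provides densities, and then the two
  conditional laws need only be compared at one common past, where the quotients defining them can
  be multiplied out again. The obstacle is to compose T conditional couplings, each depending
  measurably on a pair of pasts. Kernels are therefore represented by their action on nonnegative
  functions: composing kernels is composing functions, measurability in the starting point is built
  in, and the coupling itself is read off as a measure only after all steps have been composed. A
  prefix of a path has no type of its own. A step overwrites one coordinate of a full path, and
  "depends on the past only" is a property of functions on full paths. All densities take values in
  \<open>ennreal\<close>, so no integrability has to be carried along; the price is that vanishing
  and infinite marginals must be shown to be harmless.\<close>

lemma integral_representation:
  fixes \<Phi> :: "('z::topological_space \<Rightarrow> ennreal) \<Rightarrow> ennreal"
  assumes add: "\<And>F G. F \<in> borel_measurable borel \<Longrightarrow> G \<in> borel_measurable borel \<Longrightarrow>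
      \<Phi> (\<lambda>z. F z + G z) = \<Phi> F + \<Phi> G"
    and cmult: "\<And>c F. F \<in> borel_measurable borel \<Longrightarrow> \<Phi> (\<lambda>z. c * F z) = c * \<Phi> F"
    and sup: "\<And>U. (\<And>i::nat. U i \<in> borel_measurable borel) \<Longrightarrow> incseq U \<Longrightarrow>
      \<Phi> (\<lambda>z. SUP i. U i z) = (SUP i. \<Phi> (U i))"
  shows "\<exists>M. sets M = sets borel \<and> (\<forall>F\<in>borel_measurable borel. \<Phi> F = (\<integral>\<^sup>+ z. F z \<partial>M))"
proof -
  define M where "M = measure_of UNIV (sets (borel::'z measure)) (\<lambda>A. \<Phi> (indicator A))"
  have sets_M: "sets M = sets borel"
    unfolding M_def using sets.sigma_sets_eq[of "borel::'z measure"] by simp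
  have zero: "\<Phi> (\<lambda>z. 0) = 0"
    using cmult[of "\<lambda>z. 0" 0] by simp
  have fin: "\<Phi> (\<lambda>z. \<Sum>i<n. F i z) = (\<Sum>i<n. \<Phi> (F i))"
    if "\<And>i. F i \<in> borel_measurable borel" for F :: "nat \<Rightarrow> 'z \<Rightarrow> ennreal" and n
  proof (induction n)
    case (Suc n)
    have "\<Phi> (\<lambda>z. (\<Sum>i<n. F i z) + F n z) = \<Phi> (\<lambda>z. \<Sum>i<n. F i z) + \<Phi> (F n)"
      by (intro add) (use that in measurable)
    then show ?case by (simp add: Suc)
  qed (simp add: zero)
  have ca: "countably_additive (sets M) (\<lambda>A. \<Phi> (indicator A))"
  proof (rule countably_additiveI)
    fix A :: "nat \<Rightarrow> 'z set"
    assume A: "range A \<subseteq> sets M" "disjoint_family A"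
    have m: "(\<lambda>z. indicator (A i) z :: ennreal) \<in> borel_measurable borel" for i
      using A sets_M by (intro borel_measurable_indicator) auto
    have "indicator (\<Union> (range A)) = (\<lambda>z. SUP n. \<Sum>i<n. indicator (A i) z :: ennreal)"
      using suminf_indicator[OF A(2)] by (auto simp: suminf_eq_SUP fun_eq_iff)
    then have "\<Phi> (indicator (\<Union> (range A))) = \<Phi> (\<lambda>z. SUP n. (\<lambda>n z. \<Sum>i<n. indicator (A i) z) n z)"
      by simp
    also have "\<dots> = (SUP n. \<Phi> (\<lambda>z. \<Sum>i<n. indicator (A i) z))"
    proof (rule sup)
      show "(\<lambda>z. \<Sum>i<n. indicator (A i) z :: ennreal) \<in> borel_measurable borel" for n
        using m by measurable
      show "incseq (\<lambda>n z. \<Sum>i<n. indicator (A i) z :: ennreal)"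
        by (intro incseq_SucI le_funI) simp
    qed
    also have "\<dots> = (SUP n. \<Sum>i<n. \<Phi> (indicator (A i)))"
      using fin[OF m] by simp
    finally show "(\<Sum>i. \<Phi> (indicator (A i))) = \<Phi> (indicator (\<Union> (range A)))"
      by (simp add: suminf_eq_SUP)
  qed
  have em: "emeasure M A = \<Phi> (indicator A)" if "A \<in> sets borel" for A
  proof (rule emeasure_measure_of[OF M_def])
    show "positive (sets M) (\<lambda>A. \<Phi> (indicator A))"
      using zero by (simp add: positive_def indicator_def[abs_def])
  qed (use that sets_M ca in auto)
  have "\<Phi> F = (\<integral>\<^sup>+ z. F z \<partial>M)" if "F \<in> borel_measurable borel" for F
    using that
  proof (induction F rule: borel_measurable_induct)
    case (cong f g)
    then have "f = g" by (auto simp: fun_eq_iff)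
    with cong show ?case by simp
  next
    case (set A)
    then show ?case using em sets_M by simp
  next
    case (mult u c)
    then have "u \<in> borel_measurable M" using sets_M by (simp cong: measurable_cong_sets)
    with mult show ?case by (simp add: cmult nn_integral_cmult)
  next
    case (add u v)
    then have "u \<in> borel_measurable M" "v \<in> borel_measurable M"
      using sets_M by (simp_all cong: measurable_cong_sets)
    then show ?case using add assms(1)[of v u] by (simp add: nn_integral_add)
  next
    case (seq U)
    then have "U i \<in> borel_measurable M" for i
      using sets_M by (simp cong: measurable_cong_sets)
    with seq show ?case
      by (simp add: sup[OF seq(1,3)] nn_integral_monotone_convergence_SUP SUP_image image_comp SUP_apply)
  qed
  with sets_M show ?thesis by blast
qed

text \<open>The action of a kernel \<open>K\<close> on functions, \<open>S F z\<close> being the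
  integral of \<open>F\<close> against \<open>K z\<close>. The measures stay behind an existential
  quantifier: they serve to import integral rules at a fixed point \<open>z\<close> and are never
  handled as a measurable family.\<close>

definition kernel_op :: "(('z::topological_space \<Rightarrow> ennreal) \<Rightarrow> 'z \<Rightarrow> ennreal) \<Rightarrow> bool" where
  "kernel_op S \<longleftrightarrow>
    (\<forall>F\<in>borel_measurable borel. S F \<in> borel_measurable borel) \<and>
    (\<forall>z. \<exists>M. sets M = sets borel \<and> (\<forall>F\<in>borel_measurable borel. S F z = (\<integral>\<^sup>+ w. F w \<partial>M)))"

lemma kernel_op_measurable:
  "kernel_op S \<Longrightarrow> F \<in> borel_measurable borel \<Longrightarrow> S F \<in> borel_measurable borel"
  by (simp add: kernel_op_def)

lemma kernel_op_measure:
  assumes "kernel_op S"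
  obtains M where "sets M = sets borel"
    and "\<And>F. F \<in> borel_measurable borel \<Longrightarrow> S F z = (\<integral>\<^sup>+ w. F w \<partial>M)"
  using assms unfolding kernel_op_def by metis

lemma kernel_opI:
  fixes S :: "('z::topological_space \<Rightarrow> ennreal) \<Rightarrow> 'z \<Rightarrow> ennreal"
  assumes "\<And>F. F \<in> borel_measurable borel \<Longrightarrow> S F \<in> borel_measurable borel"
    and "\<And>F G z. F \<in> borel_measurable borel \<Longrightarrow> G \<in> borel_measurable borel \<Longrightarrow>
      S (\<lambda>z. F z + G z) z = S F z + S G z"
    and "\<And>c F z. F \<in> borel_measurable borel \<Longrightarrow> S (\<lambda>z. c * F z) z = c * S F z"
    and "\<And>U z. (\<And>i::nat. U i \<in> borel_measurable borel) \<Longrightarrow> incseq U \<Longrightarrow>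
      S (\<lambda>z. SUP i. U i z) z = (SUP i. S (U i) z)"
  shows "kernel_op S"
  unfolding kernel_op_def using assms(1) integral_representation[of "\<lambda>F. S F _"] assms(2-4) by simp

lemma kernel_op_mono:
  assumes "kernel_op S" "F \<in> borel_measurable borel" "G \<in> borel_measurable borel" "\<And>w. F w \<le> G w"
  shows "S F z \<le> S G z"
proof -
  obtain M where "sets M = sets borel"
    and M: "\<And>F. F \<in> borel_measurable borel \<Longrightarrow> S F z = (\<integral>\<^sup>+ w. F w \<partial>M)"
    using kernel_op_measure[OF assms(1)] by blast
  then show ?thesis using assms by (simp add: M nn_integral_mono)
qed

lemma kernel_op_add:
  assumes "kernel_op S" "F \<in> borel_measurable borel" "G \<in> borel_measurable borel"
  shows "S (\<lambda>w. F w + G w) z = S F z + S G z"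
proof -
  obtain M where "sets M = sets borel"
    and M: "\<And>F. F \<in> borel_measurable borel \<Longrightarrow> S F z = (\<integral>\<^sup>+ w. F w \<partial>M)"
    using kernel_op_measure[OF assms(1)] by blast
  then show ?thesis using assms
    by (simp add: M nn_integral_add cong: measurable_cong_sets)
qed

lemma kernel_op_cmult:
  assumes "kernel_op S" "F \<in> borel_measurable borel"
  shows "S (\<lambda>w. c * F w) z = c * S F z"
proof -
  obtain M where "sets M = sets borel"
    and M: "\<And>F. F \<in> borel_measurable borel \<Longrightarrow> S F z = (\<integral>\<^sup>+ w. F w \<partial>M)"
    using kernel_op_measure[OF assms(1)] by blast
  then show ?thesis using assms
    by (simp add: M nn_integral_cmult cong: measurable_cong_sets)
qed

lemma kernel_op_SUP:
  fixes U :: "nat \<Rightarrow> _"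
  assumes "kernel_op S" "\<And>i. U i \<in> borel_measurable borel" "incseq U"
  shows "S (\<lambda>w. SUP i. U i w) z = (SUP i. S (U i) z)"
proof -
  obtain M where "sets M = sets borel"
    and M: "\<And>F. F \<in> borel_measurable borel \<Longrightarrow> S F z = (\<integral>\<^sup>+ w. F w \<partial>M)"
    using kernel_op_measure[OF assms(1)] by blast
  then show ?thesis using assms
    by (simp add: M nn_integral_monotone_convergence_SUP cong: measurable_cong_sets)
qed

text \<open>Each functional property passes through a composition of operators, so
  \<open>kernel_opI\<close> applies and the composed measures never have to be written down.\<close>

lemma kernel_op_comp:
  assumes S: "kernel_op S" and T: "kernel_op T"
  shows "kernel_op (\<lambda>F. S (T F))"
proof (rule kernel_opI)
  note m = kernel_op_measurable[OF T]
  fix F G :: "'a \<Rightarrow> ennreal" and c z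
  assume F: "F \<in> borel_measurable borel"
  show "S (T F) \<in> borel_measurable borel" using S T F by (simp add: kernel_op_measurable)
  have "T (\<lambda>z. c * F z) = (\<lambda>z. c * T F z)"
    using kernel_op_cmult[OF T F] by auto
  then show "S (T (\<lambda>z. c * F z)) z = c * S (T F) z"
    using kernel_op_cmult[OF S m[OF F]] by simp
  assume G: "G \<in> borel_measurable borel"
  have "T (\<lambda>z. F z + G z) = (\<lambda>z. T F z + T G z)"
    using kernel_op_add[OF T F G] by auto
  then show "S (T (\<lambda>z. F z + G z)) z = S (T F) z + S (T G) z"
    using kernel_op_add[OF S m[OF F] m[OF G]] by simp
next
  note m = kernel_op_measurable[OF T]
  fix U :: "nat \<Rightarrow> 'a \<Rightarrow> ennreal" and z
  assume U: "\<And>i. U i \<in> borel_measurable borel" "incseq U"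
  have "T (\<lambda>z. SUP i. U i z) = (\<lambda>z. SUP i. T (U i) z)"
    using kernel_op_SUP[OF T U] by auto
  moreover have "incseq (\<lambda>i. T (U i))"
    using U by (intro monoI le_funI kernel_op_mono[OF T]) (auto simp: mono_def le_fun_def)
  ultimately show "S (T (\<lambda>z. SUP i. U i z)) z = (SUP i. S (T (U i)) z)"
    using kernel_op_SUP[OF S m[OF U(1)]] by simp
qed

text \<open>In \<open>foldr S ts F\<close> the head of \<open>ts\<close> is the outermost operator.
  With \<open>ts\<close> in increasing order of time, the last time is integrated first, given
  everything before it.\<close>

lemma kernel_op_foldr:
  assumes "\<And>t. kernel_op (S t)"
  shows "kernel_op (foldr S ts)"
proof (induction ts)
  case Nil
  show ?case
    by (rule kernel_opI) auto
next
  case (Cons t ts)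
  then show ?case using kernel_op_comp[OF assms[of t] Cons] by (simp add: comp_def)
qed

lemma kernel_op_sum:
  assumes S: "kernel_op S" and T: "kernel_op T"
  shows "kernel_op (\<lambda>F z. S F z + T F z)"
proof (rule kernel_opI)
  fix F G :: "'a \<Rightarrow> ennreal" and c z
  assume F: "F \<in> borel_measurable borel"
  show "(\<lambda>z. S F z + T F z) \<in> borel_measurable borel"
    using kernel_op_measurable[OF S F] kernel_op_measurable[OF T F] by measurable
  show "S (\<lambda>z. c * F z) z + T (\<lambda>z. c * F z) z = c * (S F z + T F z)"
    by (simp add: kernel_op_cmult[OF S F] kernel_op_cmult[OF T F] distrib_left)
  assume G: "G \<in> borel_measurable borel"
  show "S (\<lambda>z. F z + G z) z + T (\<lambda>z. F z + G z) z = S F z + T F z + (S G z + T G z)"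
    by (simp add: kernel_op_add[OF S F G] kernel_op_add[OF T F G] ac_simps)
next
  fix U :: "nat \<Rightarrow> 'a \<Rightarrow> ennreal" and z
  assume U: "\<And>i. U i \<in> borel_measurable borel" "incseq U"
  have "incseq (\<lambda>i. S (U i) z)" "incseq (\<lambda>i. T (U i) z)"
    using U by (auto intro!: monoI kernel_op_mono[OF S] kernel_op_mono[OF T] simp: mono_def le_fun_def)
  then show "S (\<lambda>z. SUP i. U i z) z + T (\<lambda>z. SUP i. U i z) z = (SUP i. S (U i) z + T (U i) z)"
    by (simp add: kernel_op_SUP[OF S U] kernel_op_SUP[OF T U] ennreal_SUP_add)
qed

text \<open>Source of all concrete kernels below: \<open>u\<close> is the value drawn,
  \<open>\<phi> z u\<close> the state after the draw and \<open>w z u\<close> the density of the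
  draw given \<open>z\<close>. Sigma-finiteness enters through the measurability of the integral in
  \<open>z\<close>.\<close>

lemma kernel_op_nn_integral:
  fixes \<phi> :: "'z::second_countable_topology \<Rightarrow> 'u::second_countable_topology \<Rightarrow> 'z"
  assumes N: "sigma_finite_measure N" "sets N = sets borel"
    and [measurable]: "case_prod \<phi> \<in> borel \<Otimes>\<^sub>M borel \<rightarrow>\<^sub>M borel"
    and [measurable]: "case_prod w \<in> borel_measurable (borel \<Otimes>\<^sub>M borel)"
  shows "kernel_op (\<lambda>F z. \<integral>\<^sup>+ u. F (\<phi> z u) * w z u \<partial>N)"
proof -
  interpret sigma_finite_measure N by fact
  note [measurable_cong] = N(2)
  show ?thesis
  proof (rule kernel_opI)
    fix F G :: "'z \<Rightarrow> ennreal" and c z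
    assume [measurable]: "F \<in> borel_measurable borel"
    show "(\<lambda>z. \<integral>\<^sup>+ u. F (\<phi> z u) * w z u \<partial>N) \<in> borel_measurable borel"
      by measurable
    show "(\<integral>\<^sup>+ u. c * F (\<phi> z u) * w z u \<partial>N) = c * (\<integral>\<^sup>+ u. F (\<phi> z u) * w z u \<partial>N)"
      unfolding mult.assoc by (rule nn_integral_cmult) measurable
    assume [measurable]: "G \<in> borel_measurable borel"
    show "(\<integral>\<^sup>+ u. (F (\<phi> z u) + G (\<phi> z u)) * w z u \<partial>N) =
        (\<integral>\<^sup>+ u. F (\<phi> z u) * w z u \<partial>N) + (\<integral>\<^sup>+ u. G (\<phi> z u) * w z u \<partial>N)"
      unfolding distrib_right by (rule nn_integral_add) measurable
  next
    fix U :: "nat \<Rightarrow> 'z \<Rightarrow> ennreal" and z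
    assume U[measurable]: "\<And>i. U i \<in> borel_measurable borel" and i: "incseq U"
    have "(SUP i. U i (\<phi> z u)) * w z u = (SUP i. U i (\<phi> z u) * w z u)" for u
      by (simp add: SUP_mult_right_ennreal)
    moreover have "(\<integral>\<^sup>+ u. (SUP i. U i (\<phi> z u) * w z u) \<partial>N) = (SUP i. \<integral>\<^sup>+ u. U i (\<phi> z u) * w z u \<partial>N)"
      using i by (intro nn_integral_monotone_convergence_SUP)
        (auto simp: mono_def le_fun_def intro!: mult_right_mono)
    ultimately show "(\<integral>\<^sup>+ u. (SUP i. U i (\<phi> z u)) * w z u \<partial>N) = (SUP i. \<integral>\<^sup>+ u. U i (\<phi> z u) * w z u \<partial>N)"
      by simp
  qed
qed

section \<open>Conditional densities\<close>

definition upd :: "'a ^ 't \<Rightarrow> 't \<Rightarrow> 'a \<Rightarrow> 'a ^ 't::finite" where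
  "upd x t a = (\<chi> s. if s = t then a else x $ s)"

lemma upd_nth [simp]: "upd x t a $ s = (if s = t then a else x $ s)"
  by (simp add: upd_def)

lemma measurable_upd [measurable]:
  fixes X :: "'m \<Rightarrow> 'a::euclidean_space ^ 't::finite"
  assumes [measurable]: "X \<in> borel_measurable M" "Y \<in> borel_measurable M"
  shows "(\<lambda>w. upd (X w) t (Y w)) \<in> borel_measurable M"
proof -
  have "continuous_on UNIV (\<lambda>z :: ('a ^ 't) \<times> 'a. \<chi> s. if s = t then snd z else fst z $ s)"
  proof (rule continuous_on_vec_lambda)
    show "continuous_on UNIV (\<lambda>z :: ('a ^ 't) \<times> 'a. if s = t then snd z else fst z $ s)" for s
      by (cases "s = t") (auto intro!: continuous_intros)
  qed
  then have *: "(\<lambda>z :: ('a ^ 't) \<times> 'a. upd (fst z) t (snd z)) \<in> borel_measurable borel"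
    unfolding upd_def by (rule borel_measurable_continuous_onI)
  have "(\<lambda>w. (X w, Y w)) \<in> borel_measurable M"
    by measurable
  from measurable_compose[OF this *] show ?thesis by simp
qed

definition coord_int ::
  "'t \<Rightarrow> ('a::euclidean_space ^ 't::finite \<Rightarrow> ennreal) \<Rightarrow> 'a ^ 't \<Rightarrow> ennreal" where
  "coord_int t F x = (\<integral>\<^sup>+ a. F (upd x t a) \<partial>lborel)"

lemma kernel_op_coord_int: "kernel_op (coord_int t)"
  using kernel_op_nn_integral[of lborel "\<lambda>x a. upd x t a" "\<lambda>_ _. 1"]
  by (simp add: coord_int_def[abs_def] lborel.sigma_finite_measure_axioms)

lemmas kernel_op_coord_ints = kernel_op_foldr[of coord_int, OF kernel_op_coord_int]

lemma coord_int_measurable [measurable]: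
  "F \<in> borel_measurable borel \<Longrightarrow> coord_int t F \<in> borel_measurable borel"
  by (rule kernel_op_measurable[OF kernel_op_coord_int])

lemma coord_ints_measurable [measurable]:
  "F \<in> borel_measurable borel \<Longrightarrow> foldr coord_int ts F \<in> borel_measurable borel"
  by (rule kernel_op_measurable[OF kernel_op_coord_ints])

lemma measurable_vec_lambda_PiM:
  "vec_lambda \<in> (\<Pi>\<^sub>M s\<in>(UNIV :: 't::finite set). (lborel :: 'a::euclidean_space measure)) \<rightarrow>\<^sub>M borel"
proof (subst borel_measurable_euclidean_space, rule ballI)
  fix i :: "'a ^ 't" assume "i \<in> Basis"
  then obtain s b where i: "i = axis s b" by (auto simp: Basis_vec_def)
  show "(\<lambda>x. vec_lambda x \<bullet> i) \<in> borel_measurable (\<Pi>\<^sub>M s\<in>(UNIV :: 't set). (lborel :: 'a measure))"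
    unfolding i inner_axis by simp
qed

text \<open>The basis of the path space consists of the vectors \<open>axis s b\<close>, so the
  volume of a box is a product over times \<open>s\<close> of products over basis vectors
  \<open>b\<close>, which is the product measure of that box.\<close>

lemma lborel_vec:
  "(lborel :: ('a::euclidean_space ^ 't::finite) measure) = distr (\<Pi>\<^sub>M s\<in>UNIV. lborel) borel vec_lambda"
proof (rule lborel_eqI)
  interpret product_sigma_finite "\<lambda>_::'t. lborel :: 'a measure"
    by standard
  fix l u :: "'a ^ 't"
  assume le: "\<And>b. b \<in> Basis \<Longrightarrow> l \<bullet> b \<le> u \<bullet> b"
  have le': "l $ s \<bullet> b \<le> u $ s \<bullet> b" if "b \<in> Basis" for s b
    using le[of "axis s b"] that by (simp add: inner_axis)
  have "vec_lambda -` box l u \<inter> space (\<Pi>\<^sub>M s\<in>(UNIV :: 't set). (lborel :: 'a measure)) =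
      PiE UNIV (\<lambda>s. box (l $ s) (u $ s))"
    by (auto simp: mem_box Basis_vec_def inner_axis PiE_iff space_PiM)
  then have "emeasure (distr (\<Pi>\<^sub>M s\<in>(UNIV :: 't set). (lborel :: 'a measure)) borel vec_lambda) (box l u) =
      (\<Prod>s\<in>UNIV. emeasure lborel (box (l $ s) (u $ s)))"
    by (simp add: emeasure_distr measurable_vec_lambda_PiM emeasure_PiM)
  also have "\<dots> = (\<Prod>s\<in>UNIV. \<Prod>b\<in>Basis. ennreal ((u $ s - l $ s) \<bullet> b))"
    using le' by (simp add: emeasure_lborel_box prod_ennreal inner_diff_left)
  also have "\<dots> = (\<Prod>(s, b)\<in>UNIV \<times> Basis. ennreal ((u - l) \<bullet> axis s b))"
    by (simp add: prod.cartesian_product inner_axis)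
  also have "\<dots> = (\<Prod>i\<in>(\<lambda>(s, b). axis s b) ` (UNIV \<times> Basis). ennreal ((u - l) \<bullet> i))"
    by (subst prod.reindex) (auto simp: inj_on_def axis_eq_axis case_prod_beta)
  also have "(\<lambda>(s, b). axis s b) ` (UNIV \<times> Basis) = (Basis :: ('a ^ 't) set)"
    by (auto simp: Basis_vec_def)
  also have "(\<Prod>i\<in>Basis. ennreal ((u - l) \<bullet> i)) = ennreal (\<Prod>i\<in>Basis. (u - l) \<bullet> i)"
    using le by (intro prod_ennreal) (simp add: inner_diff_left)
  finally show "emeasure (distr (\<Pi>\<^sub>M s\<in>(UNIV :: 't set). (lborel :: 'a measure)) borel vec_lambda) (box l u) =
      ennreal (\<Prod>i\<in>Basis. (u - l) \<bullet> i)" .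
qed simp

lemma foldr_coord_int_eq_nn_integral:
  fixes F :: "'a::euclidean_space ^ 't::finite \<Rightarrow> ennreal"
  assumes F: "F \<in> borel_measurable borel" and ts: "distinct ts" "set ts = UNIV"
  shows "foldr coord_int ts F (\<chi> s. undefined) = (\<integral>\<^sup>+ x. F x \<partial>lborel)"
proof -
  interpret product_sigma_finite "\<lambda>_::'t. lborel :: 'a measure"
    by standard
  define C where "C = (\<lambda>(t::'t) F (u :: 't \<Rightarrow> 'a). \<integral>\<^sup>+ a. F (u(t := a)) \<partial>lborel :: ennreal)"
  \<comment> \<open>The list is taken apart at its end, because \<open>foldr\<close> integrates the
    last coordinate first; this is the order in which a coordinate is split off a product measure.
    \<open>C\<close> is \<open>coord_int\<close> for functions on tuples instead of vectors.\<close>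
  have iter: "foldr C ts H (\<lambda>_. undefined) = (\<integral>\<^sup>+ u. H u \<partial>Pi\<^sub>M (set ts) (\<lambda>_. lborel))"
    if "distinct ts" "H \<in> borel_measurable (Pi\<^sub>M (set ts) (\<lambda>_. lborel))" for ts H
    using that
  proof (induction ts arbitrary: H rule: rev_induct)
    case Nil
    show ?case by (simp add: nn_integral_empty)
  next
    case (snoc t ts)
    have H[measurable]: "H \<in> borel_measurable (Pi\<^sub>M (insert t (set ts)) (\<lambda>_. lborel))"
      using snoc.prems by simp
    have "C t H \<in> borel_measurable (Pi\<^sub>M (set ts) (\<lambda>_. lborel))"
      unfolding C_def by measurable
    then have "foldr C (ts @ [t]) H (\<lambda>_. undefined) = (\<integral>\<^sup>+ u. C t H u \<partial>Pi\<^sub>M (set ts) (\<lambda>_. lborel))"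
      using snoc by simp
    also have "\<dots> = (\<integral>\<^sup>+ u. H u \<partial>Pi\<^sub>M (insert t (set ts)) (\<lambda>_. lborel))"
      using snoc.prems unfolding C_def by (intro product_nn_integral_insert[symmetric] H) auto
    finally show ?case by simp
  qed
  have "upd (vec_lambda u) t a = vec_lambda (u(t := a))" for u :: "'t \<Rightarrow> 'a" and t a
    by (simp add: vec_eq_iff)
  then have transfer: "foldr coord_int ts F (vec_lambda u) = foldr C ts (\<lambda>u. F (vec_lambda u)) u" for ts u
    by (induction ts arbitrary: u) (simp_all add: C_def coord_int_def)
  have "(\<lambda>u. F (vec_lambda u)) \<in> borel_measurable (Pi\<^sub>M (set ts) (\<lambda>_. lborel))"
    using measurable_compose[OF measurable_vec_lambda_PiM F] ts by simp
  from iter[OF ts(1) this] have "foldr coord_int ts F (\<chi> s. undefined) =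
      (\<integral>\<^sup>+ u. F (vec_lambda u) \<partial>Pi\<^sub>M UNIV (\<lambda>_. lborel))"
    using transfer[of ts "\<lambda>_. undefined"] ts by simp
  also have "\<dots> = (\<integral>\<^sup>+ x. F x \<partial>lborel)"
    by (subst lborel_vec) (simp add: nn_integral_distr measurable_vec_lambda_PiM F)
  finally show ?thesis .
qed

section \<open>Functions of part of the coordinates\<close>

definition depends_on :: "'t set \<Rightarrow> ('a ^ 't::finite \<Rightarrow> 'b) \<Rightarrow> bool" where
  "depends_on A F \<longleftrightarrow> (\<forall>x y. (\<forall>s\<in>A. x $ s = y $ s) \<longrightarrow> F x = F y)"

lemma depends_onD: "depends_on A F \<Longrightarrow> (\<And>s. s \<in> A \<Longrightarrow> x $ s = y $ s) \<Longrightarrow> F x = F y"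
  by (auto simp: depends_on_def)

lemma depends_on_UNIV [simp]: "depends_on UNIV F"
  by (auto simp: depends_on_def simp flip: vec_eq_iff)

lemma depends_on_coord_int:
  assumes "depends_on (insert t A) F"
  shows "depends_on A (coord_int t F)"
proof -
  have "F (upd x t a) = F (upd y t a)" if "\<forall>s\<in>A. x $ s = y $ s" for x y a
    by (rule depends_onD[OF assms]) (use that in auto)
  then show ?thesis
    unfolding depends_on_def coord_int_def by (intro allI impI nn_integral_cong)
qed

lemma depends_on_coord_ints:
  "depends_on (set ts \<union> A) F \<Longrightarrow> depends_on A (foldr coord_int ts F)"
  by (induction ts arbitrary: A) (auto intro!: depends_on_coord_int)

lemma times_append:
  assumes "as @ t # bs = sorted_list_of_set (UNIV :: 't::{finite, linorder} set)"
  shows "set as = {..<t}" "set bs = {t<..}" "bs = sorted_list_of_set {t<..}"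
proof -
  have s: "sorted_wrt (<) (as @ t # bs)" "set (as @ t # bs) = UNIV"
    unfolding assms by simp_all
  then have le: "\<forall>s\<in>set as. s < t" "\<forall>s\<in>set bs. t < s"
    by (auto simp: sorted_wrt_append)
  with s(2) show 1: "set as = {..<t}" "set bs = {t<..}"
    by (auto simp: set_eq_iff) (metis order_less_asym order_less_irrefl)+
  show "bs = sorted_list_of_set {t<..}"
    using s(1) 1(2) by (intro sorted_distinct_set_unique)
      (auto simp: sorted_wrt_append strict_sorted_iff)
qed

text \<open>For a probability density \<open>g\<close>, the density of the path up to and including
  time \<open>t\<close>, kept as a function of the full path. One more \<open>coord_int t\<close>
  gives the density of the strict past, so that needs no notion of its own, and the first time is no
  special case: there the strict past carries just the constant total mass.\<close>

definition marginal_density ::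
  "(('a::euclidean_space, 't::{finite, linorder}) vec \<Rightarrow> ennreal) \<Rightarrow> 't \<Rightarrow> ('a, 't) vec \<Rightarrow> ennreal" where
  "marginal_density g t = foldr coord_int (sorted_list_of_set {t<..}) g"

text \<open>
  Marginals of a density may vanish, or be infinite on a null set of pasts. The uniform law on a cube
  is a fallback that makes every conditional law a probability measure.
\<close>

definition cond_density ::
  "(('a::euclidean_space, 't::{finite, linorder}) vec \<Rightarrow> ennreal) \<Rightarrow> 't \<Rightarrow> ('a, 't) vec \<Rightarrow> 'a \<Rightarrow> ennreal" where
  "cond_density g t x a =
    (let N = coord_int t (marginal_density g t) x
     in if N = 0 \<or> N = \<top> then indicator (cbox 0 One) a else marginal_density g t (upd x t a) / N)"

definition cond_op ::
  "(('a::euclidean_space, 't::{finite, linorder}) vec \<Rightarrow> ennreal) \<Rightarrow> 't \<Rightarrow>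
   (('a, 't) vec \<Rightarrow> ennreal) \<Rightarrow> ('a, 't) vec \<Rightarrow> ennreal" where
  "cond_op g t F x = (\<integral>\<^sup>+ a. F (upd x t a) * cond_density g t x a \<partial>lborel)"

lemma marginal_density_measurable [measurable]:
  "g \<in> borel_measurable borel \<Longrightarrow> marginal_density g t \<in> borel_measurable borel"
  unfolding marginal_density_def by measurable

lemma cond_density_measurable [measurable]:
  assumes [measurable]: "g \<in> borel_measurable borel" "X \<in> borel_measurable M" "Y \<in> borel_measurable M"
  shows "(\<lambda>w. cond_density g t (X w) (Y w)) \<in> borel_measurable M"
  unfolding cond_density_def Let_def by measurable

lemma nn_integral_cond_density [simp]:
  assumes [measurable]: "g \<in> borel_measurable borel"
  shows "(\<integral>\<^sup>+ a. cond_density g t x a \<partial>lborel) = 1"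
proof (cases "coord_int t (marginal_density g t) x = 0 \<or> coord_int t (marginal_density g t) x = \<top>")
  case True
  have "emeasure lborel (cbox (0::'a) One) = 1"
    by (subst emeasure_lborel_cbox) auto
  with True show ?thesis by (simp add: cond_density_def)
next
  case False
  then have "coord_int t (marginal_density g t) x / coord_int t (marginal_density g t) x = 1"
    by (intro ennreal_divide_self) (auto simp: less_top)
  with False show ?thesis
    by (simp add: cond_density_def nn_integral_divide flip: coord_int_def)
qed

lemma depends_on_marginal_density: "depends_on {..t} (marginal_density g t)"
proof -
  have "set (sorted_list_of_set {t<..}) \<union> {..t} = UNIV"
    by auto
  then show ?thesis
    unfolding marginal_density_def by (intro depends_on_coord_ints) simp
qed

text \<open>This is where causality comes from: coordinate \<open>t\<close> is overwritten by
  \<open>upd\<close> and later ones are integrated out, so only the strict past can matter.\<close>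

lemma cond_density_cong:
  assumes "\<And>s. s < t \<Longrightarrow> x $ s = y $ s"
  shows "cond_density g t x a = cond_density g t y a"
proof -
  have "marginal_density g t (upd x t a) = marginal_density g t (upd y t a)" for a
    by (rule depends_onD[OF depends_on_marginal_density]) (use assms in auto)
  then show ?thesis unfolding cond_density_def coord_int_def by (simp cong: if_cong)
qed

lemma kernel_op_cond_op:
  assumes [measurable]: "g \<in> borel_measurable borel"
  shows "kernel_op (cond_op g t)"
  unfolding cond_op_def[abs_def]
  by (rule kernel_op_nn_integral) (auto simp: lborel.sigma_finite_measure_axioms)

lemmas kernel_op_cond_ops = kernel_op_foldr[of "cond_op g" for g, OF kernel_op_cond_op]

lemma cond_op_measurable [measurable]:
  "g \<in> borel_measurable borel \<Longrightarrow> F \<in> borel_measurable borel \<Longrightarrow> cond_op g t F \<in> borel_measurable borel"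
  by (rule kernel_op_measurable[OF kernel_op_cond_op])

lemma cond_ops_measurable [measurable]:
  "g \<in> borel_measurable borel \<Longrightarrow> F \<in> borel_measurable borel \<Longrightarrow>
    foldr (cond_op g) ts F \<in> borel_measurable borel"
  by (rule kernel_op_measurable[OF kernel_op_cond_ops])

lemma depends_on_cond_op:
  assumes "depends_on (insert t A) F" "{..<t} \<subseteq> A"
  shows "depends_on A (cond_op g t F)"
proof -
  have "F (upd x t a) = F (upd y t a)" "cond_density g t x a = cond_density g t y a"
    if "\<forall>s\<in>A. x $ s = y $ s" for x y a
    using that assms(2) by (auto intro!: depends_onD[OF assms(1)] cond_density_cong)
  then show ?thesis
    unfolding depends_on_def cond_op_def by (intro allI impI nn_integral_cong arg_cong2[of _ _ _ _ "(*)"])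
qed

lemma depends_on_cond_ops:
  assumes "as @ bs = sorted_list_of_set UNIV"
  shows "depends_on (set as) (foldr (cond_op g) bs F)"
  using assms
proof (induction bs arbitrary: as)
  case (Cons t bs)
  then have "depends_on (set (as @ [t])) (foldr (cond_op g) bs F)"
    by (intro Cons.IH) simp
  then show ?case
    using times_append(1)[OF Cons.prems] by (auto intro!: depends_on_cond_op)
next
  case Nil
  then have "set as = UNIV" by (metis append_Nil2 finite set_sorted_list_of_set)
  then show ?case by simp
qed

section \<open>Disintegration of a density along time\<close>

lemma coord_int_mult_left:
  assumes "F \<in> borel_measurable borel" "depends_on (- {t}) c"
  shows "coord_int t (\<lambda>x. c x * F x) x = c x * coord_int t F x"
proof -
  note assms(1)[measurable]
  have "c (upd x t a) = c x" for a
    by (rule depends_onD[OF assms(2)]) simp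
  then show ?thesis by (simp add: coord_int_def nn_integral_cmult)
qed

lemma coord_ints_mult_left:
  assumes "F \<in> borel_measurable borel" "depends_on (- set ts) c"
  shows "foldr coord_int ts (\<lambda>x. c x * F x) x = c x * foldr coord_int ts F x"
  using assms(2)
proof (induction ts arbitrary: x)
  case (Cons t ts)
  have *: "depends_on (- set ts) c" "depends_on (- {t}) c"
    using Cons.prems by (auto simp: depends_on_def)
  have "foldr coord_int ts (\<lambda>x. c x * F x) = (\<lambda>x. c x * foldr coord_int ts F x)"
    using Cons.IH[OF *(1)] by auto
  then show ?case
    using assms(1) *(2) by (simp add: coord_int_mult_left)
qed simp

text \<open>Density up to \<open>t\<close> equals density of the strict past times conditional
  density. Where the past has density 0 the fallback law is harmless, since the density up to
  \<open>t\<close> then vanishes for almost every value at \<open>t\<close>. An infinite past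
  density cannot be cancelled and is excluded.\<close>

lemma coord_int_marginal_density_cond_op:
  assumes [measurable]: "g \<in> borel_measurable borel" "F \<in> borel_measurable borel"
    and fin: "coord_int t (marginal_density g t) x \<noteq> \<top>"
  shows "coord_int t (\<lambda>x. marginal_density g t x * F x) x =
    coord_int t (marginal_density g t) x * cond_op g t F x"
proof (cases "coord_int t (marginal_density g t) x = 0")
  case True
  then have "AE a in lborel. marginal_density g t (upd x t a) = 0"
    by (simp add: coord_int_def nn_integral_0_iff_AE)
  then have "AE a in lborel. marginal_density g t (upd x t a) * F (upd x t a) = 0"
    by eventually_elim simp
  then have "coord_int t (\<lambda>x. marginal_density g t x * F x) x = 0"
    unfolding coord_int_def by (subst nn_integral_0_iff_AE) auto
  with True show ?thesis by simp
next
  case False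
  define N where "N = coord_int t (marginal_density g t) x"
  have N: "N \<noteq> 0" "N \<noteq> \<top>" using False fin by (auto simp: N_def)
  have "N * (F y * (m / N)) = m * F y" for y m
  proof -
    have "N * (F y * (m / N)) = (m * F y) * (N / N)"
      by (simp add: ennreal_times_divide ac_simps)
    then show ?thesis using N by (simp add: ennreal_divide_self less_top)
  qed
  then have "N * cond_op g t F x = coord_int t (\<lambda>x. marginal_density g t x * F x) x"
    using N by (simp add: cond_op_def cond_density_def coord_int_def N_def Let_def flip: nn_integral_cmult)
  then show ?thesis by (simp add: N_def)
qed

text \<open>The bad pasts have to be null for the measure \<open>M\<close> that represents the outer
  integrations from the fixed starting path \<open>x\<close>; a finite total mass gives exactly
  this.\<close>

lemma coord_ints_AE_finite:
  fixes g :: "'a::euclidean_space ^ 't::{finite, linorder} \<Rightarrow> ennreal"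
  assumes [measurable]: "g \<in> borel_measurable borel"
    and fin: "foldr coord_int (as @ bs) g x \<noteq> \<top>"
    and M: "sets M = sets borel"
      "\<And>F. F \<in> borel_measurable borel \<Longrightarrow> foldr coord_int as F x = (\<integral>\<^sup>+ w. F w \<partial>M)"
  shows "AE y in M. foldr coord_int bs g y \<noteq> \<top>"
proof -
  note [measurable_cong] = M(1)
  have "(\<integral>\<^sup>+ w. foldr coord_int bs g w \<partial>M) \<noteq> \<infinity>"
    using fin M(2)[of "foldr coord_int bs g"] by simp
  then show ?thesis
    using nn_integral_noteq_infinite[of "foldr coord_int bs g" M] by simp
qed

text \<open>Interpolates between plain integration against \<open>g\<close> (when \<open>bs\<close>
  is empty) and pure iteration of conditional laws (when \<open>as\<close> is empty). The induction
  moves one time \<open>t\<close> across the border: the integral over coordinate \<open>t\<close>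
  of the marginal density is traded for a conditional expectation, \<open>M\<close>-almost
  everywhere.\<close>

lemma coord_ints_cond_ops:
  fixes g :: "'a::euclidean_space ^ 't::{finite, linorder} \<Rightarrow> ennreal"
  assumes [measurable]: "g \<in> borel_measurable borel" "F \<in> borel_measurable borel"
    and "as @ bs = sorted_list_of_set UNIV"
    and fin: "foldr coord_int (as @ bs) g x \<noteq> \<top>"
  shows "foldr coord_int as (\<lambda>x. foldr coord_int bs g x * foldr (cond_op g) bs F x) x =
    foldr coord_int (as @ bs) (\<lambda>x. g x * F x) x"
  using assms(3-)
proof (induction bs arbitrary: as)
  case (Cons t bs)
  obtain M where M: "sets M = sets borel"
    "\<And>F. F \<in> borel_measurable borel \<Longrightarrow> foldr coord_int as F x = (\<integral>\<^sup>+ w. F w \<partial>M)"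
    using kernel_op_measure[OF kernel_op_coord_ints] by blast
  have m: "foldr coord_int bs g = marginal_density g t"
    using times_append(3)[OF Cons.prems(1)] by (simp add: marginal_density_def)
  have "foldr coord_int (as @ t # bs) (\<lambda>x. g x * F x) x =
      foldr coord_int as (coord_int t (\<lambda>x. marginal_density g t x * foldr (cond_op g) bs F x)) x"
    using Cons.IH[of "as @ [t]"] Cons.prems by (simp add: m)
  also have "\<dots> = foldr coord_int as (\<lambda>x. coord_int t (marginal_density g t) x * cond_op g t (foldr (cond_op g) bs F) x) x"
  proof -
    have "AE y in M. coord_int t (marginal_density g t) y \<noteq> \<top>"
      using coord_ints_AE_finite[OF assms(1) Cons.prems(2) M] by (simp add: m)
    then have "AE y in M. coord_int t (\<lambda>x. marginal_density g t x * foldr (cond_op g) bs F x) y =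
        coord_int t (marginal_density g t) y * cond_op g t (foldr (cond_op g) bs F) y"
      by eventually_elim (simp add: coord_int_marginal_density_cond_op)
    then show ?thesis
      by (simp add: M(2) nn_integral_cong_AE)
  qed
  finally show ?case by (simp add: m)
qed simp

lemma cond_ops_eq_nn_integral:
  fixes g :: "'a::euclidean_space ^ 't::{finite, linorder} \<Rightarrow> ennreal"
  assumes [measurable]: "g \<in> borel_measurable borel" "F \<in> borel_measurable borel"
    and "(\<integral>\<^sup>+ x. g x \<partial>lborel) = 1"
  shows "foldr (cond_op g) (sorted_list_of_set UNIV) F (\<chi> s. undefined) = (\<integral>\<^sup>+ x. g x * F x \<partial>lborel)"
  using coord_ints_cond_ops[of g F "[]" "sorted_list_of_set UNIV" "\<chi> s. undefined"] assms(3)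
  by (simp add: foldr_coord_int_eq_nn_integral)

section \<open>Stepwise maximal couplings\<close>

text \<open>The positive part of the difference. In \<open>ennreal\<close> the difference of \<top>
  and \<top> is \<top>; the case distinction makes it 0.\<close>

definition excess :: "ennreal \<Rightarrow> ennreal \<Rightarrow> ennreal" where
  "excess p q = (if p \<le> q then 0 else p - q)"

lemma min_add_excess: "min p q + excess p q = p"
  by (auto simp: excess_def min_def not_le less_imp_le)

lemma excess_le_diff: "p \<noteq> \<top> \<Longrightarrow> excess p q = p - q"
  by (auto simp: excess_def diff_eq_0_ennreal less_top)

lemma excess_measurable [measurable]:
  assumes [measurable]: "f \<in> borel_measurable M" "g \<in> borel_measurable M"
  shows "(\<lambda>w. excess (f w) (g w)) \<in> borel_measurable M"
  unfolding excess_def by measurable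

text \<open>For probability densities, their total variation distance, normalised to have maximum 1:
  the mass of the first law that cannot be matched with the second.\<close>

definition defect :: "('a::euclidean_space \<Rightarrow> ennreal) \<Rightarrow> ('a \<Rightarrow> ennreal) \<Rightarrow> ennreal" where
  "defect p q = (\<integral>\<^sup>+ a. excess (p a) (q a) \<partial>lborel)"

lemma defect_add_nn_integral_min:
  assumes [measurable]: "p \<in> borel_measurable borel" "q \<in> borel_measurable borel"
  shows "(\<integral>\<^sup>+ a. min (p a) (q a) \<partial>lborel) + defect p q = (\<integral>\<^sup>+ a. p a \<partial>lborel)"
  unfolding defect_def by (simp add: min_add_excess flip: nn_integral_add)

text \<open>Either defect completes the same overlap, the integral of the minimum, to mass 1; the
  overlap is finite and cancels.\<close>

lemma defect_commute:
  assumes [measurable]: "p \<in> borel_measurable borel" "q \<in> borel_measurable borel"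
    and "(\<integral>\<^sup>+ a. p a \<partial>lborel) = 1" "(\<integral>\<^sup>+ a. q a \<partial>lborel) = 1"
  shows "defect q p = defect p q"
proof -
  have "(\<integral>\<^sup>+ a. min (p a) (q a) \<partial>lborel) \<le> (\<integral>\<^sup>+ a. p a \<partial>lborel)"
    by (intro nn_integral_mono) simp
  then have "(\<integral>\<^sup>+ a. min (p a) (q a) \<partial>lborel) \<noteq> \<top>"
    using assms(3) by (auto simp: top_unique)
  moreover have "(\<integral>\<^sup>+ a. min (p a) (q a) \<partial>lborel) + defect q p =
      (\<integral>\<^sup>+ a. min (p a) (q a) \<partial>lborel) + defect p q"
    using defect_add_nn_integral_min[of p q] defect_add_nn_integral_min[of q p] assms
    by (simp add: min.commute)
  ultimately show ?thesis
    by (simp add: ennreal_add_left_cancel)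
qed

lemma defect_le_1:
  assumes "p \<in> borel_measurable borel" "q \<in> borel_measurable borel"
    and "(\<integral>\<^sup>+ a. p a \<partial>lborel) = 1"
  shows "defect p q \<le> 1"
  using defect_add_nn_integral_min[OF assms(1,2)] assms(3) by (metis le_iff_add add.commute)

lemma nn_integral_lborel_prod:
  fixes f :: "'a::euclidean_space \<Rightarrow> ennreal" and g :: "'b::euclidean_space \<Rightarrow> ennreal"
  assumes [measurable]: "f \<in> borel_measurable borel" "g \<in> borel_measurable borel"
  shows "(\<integral>\<^sup>+ c. f (fst c) * g (snd c) \<partial>lborel) = (\<integral>\<^sup>+ a. f a \<partial>lborel) * (\<integral>\<^sup>+ b. g b \<partial>lborel)"
proof -
  have "(\<integral>\<^sup>+ c. f (fst c) * g (snd c) \<partial>lborel) = (\<integral>\<^sup>+ a. \<integral>\<^sup>+ b. f a * g b \<partial>lborel \<partial>lborel)"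
    unfolding lborel_prod[symmetric] by (subst lborel.nn_integral_fst[symmetric]) auto
  then show ?thesis
    by (simp add: nn_integral_cmult nn_integral_multc)
qed

text \<open>Both remainders have mass \<open>defect p q\<close>, so dividing their product once by
  this mass leaves a measure whose marginals are the remainders themselves.\<close>

definition residual :: "('a::euclidean_space \<Rightarrow> ennreal) \<Rightarrow> ('a \<Rightarrow> ennreal) \<Rightarrow> 'a \<times> 'a \<Rightarrow> ennreal" where
  "residual p q c = excess (p (fst c)) (q (fst c)) * (excess (q (snd c)) (p (snd c)) / defect p q)"

lemma residual_measurable [measurable]:
  fixes p q :: "'a::euclidean_space \<Rightarrow> ennreal"
  assumes [measurable]: "p \<in> borel_measurable borel" "q \<in> borel_measurable borel"
  shows "residual p q \<in> borel_measurable borel"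
  unfolding residual_def[abs_def] borel_prod[symmetric] by measurable

text \<open>Integrating out the other variable produces \<open>defect p q / defect p q\<close>, by
  \<open>defect_commute\<close> with the same normaliser on both sides. It is 1 unless the defect is
  0, and then the remainder vanishes almost everywhere and both integrals are 0.\<close>

lemma nn_integral_residual:
  assumes m[measurable]: "p \<in> borel_measurable borel" "q \<in> borel_measurable borel"
    and one: "(\<integral>\<^sup>+ a. p a \<partial>lborel) = 1" "(\<integral>\<^sup>+ a. q a \<partial>lborel) = 1"
    and G[measurable]: "G \<in> borel_measurable borel"
  shows "(\<integral>\<^sup>+ c. G (fst c) * residual p q c \<partial>lborel) = (\<integral>\<^sup>+ a. G a * excess (p a) (q a) \<partial>lborel)"
    and "(\<integral>\<^sup>+ c. G (snd c) * residual p q c \<partial>lborel) = (\<integral>\<^sup>+ b. G b * excess (q b) (p b) \<partial>lborel)"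
proof -
  have d: "(\<integral>\<^sup>+ a. excess (p a) (q a) \<partial>lborel) = defect p q" "(\<integral>\<^sup>+ a. excess (q a) (p a) \<partial>lborel) = defect p q"
    using defect_commute[OF m one] by (simp_all add: defect_def)
  have zero: "(\<integral>\<^sup>+ a. G a * e a \<partial>lborel) = 0"
    if "(\<integral>\<^sup>+ a. e a \<partial>lborel) = defect p q" "defect p q = 0"
      and [measurable]: "e \<in> borel_measurable borel" for e
  proof -
    have "AE a in lborel. e a = 0"
      using that by (simp add: nn_integral_0_iff_AE)
    then have "AE a in lborel. G a * e a = 0"
      by eventually_elim simp
    then show ?thesis by (subst nn_integral_0_iff_AE) auto
  qed
  have one': "defect p q / defect p q = 1" if "defect p q \<noteq> 0"
    using that defect_le_1[OF m one(1)] by (intro ennreal_divide_self) (auto simp: order_le_less_trans)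
  have "(\<integral>\<^sup>+ c. G (fst c) * residual p q c \<partial>lborel) =
      (\<integral>\<^sup>+ c. (\<lambda>a. G a * excess (p a) (q a)) (fst c) * (\<lambda>b. excess (q b) (p b) / defect p q) (snd c) \<partial>lborel)"
    by (simp add: residual_def ac_simps)
  also have "\<dots> = (\<integral>\<^sup>+ a. G a * excess (p a) (q a) \<partial>lborel) * (defect p q / defect p q)"
    by (subst nn_integral_lborel_prod) (simp_all add: nn_integral_divide d)
  finally show "(\<integral>\<^sup>+ c. G (fst c) * residual p q c \<partial>lborel) = (\<integral>\<^sup>+ a. G a * excess (p a) (q a) \<partial>lborel)"
    using zero[OF d(1)] one' by (cases "defect p q = 0") auto
  have "(\<integral>\<^sup>+ c. G (snd c) * residual p q c \<partial>lborel) =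
      (\<integral>\<^sup>+ c. (\<lambda>a. excess (p a) (q a)) (fst c) * (\<lambda>b. G b * excess (q b) (p b) / defect p q) (snd c) \<partial>lborel)"
    by (simp add: residual_def ennreal_times_divide ac_simps)
  also have "\<dots> = defect p q * ((\<integral>\<^sup>+ b. G b * excess (q b) (p b) \<partial>lborel) / defect p q)"
    by (subst nn_integral_lborel_prod) (simp_all add: nn_integral_divide d)
  also have "\<dots> = (\<integral>\<^sup>+ b. G b * excess (q b) (p b) \<partial>lborel) * (defect p q / defect p q)"
    by (metis ennreal_times_divide mult.commute)
  finally show "(\<integral>\<^sup>+ c. G (snd c) * residual p q c \<partial>lborel) = (\<integral>\<^sup>+ b. G b * excess (q b) (p b) \<partial>lborel)"
    using zero[OF d(2)] one' by (cases "defect p q = 0") auto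
qed

text \<open>
  The first summand is the common part of the two conditional laws, on the diagonal; the second is
  the product of their remainders. The two pasts may differ: how the coordinates are
  coupled after the paths have separated is irrelevant, so no case distinction is needed.
\<close>

definition coupling_op ::
  "(('a::euclidean_space, 't::{finite, linorder}) vec \<Rightarrow> ennreal) \<Rightarrow> (('a, 't) vec \<Rightarrow> ennreal) \<Rightarrow> 't \<Rightarrow>
   (('a, 't) vec \<times> ('a, 't) vec \<Rightarrow> ennreal) \<Rightarrow> ('a, 't) vec \<times> ('a, 't) vec \<Rightarrow> ennreal" where
  "coupling_op g h t F z =
    (\<integral>\<^sup>+ a. F (upd (fst z) t a, upd (snd z) t a) *
        min (cond_density g t (fst z) a) (cond_density h t (snd z) a) \<partial>lborel) +
    (\<integral>\<^sup>+ c. F (upd (fst z) t (fst c), upd (snd z) t (snd c)) *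
        residual (cond_density g t (fst z)) (cond_density h t (snd z)) c \<partial>lborel)"

lemma defect_cond_density_measurable [measurable]:
  assumes [measurable]: "g \<in> borel_measurable borel" "h \<in> borel_measurable borel"
    "X \<in> borel_measurable M" "Y \<in> borel_measurable M"
  shows "(\<lambda>w. defect (cond_density g t (X w)) (cond_density h t (Y w))) \<in> borel_measurable M"
  unfolding defect_def by measurable

lemma kernel_op_coupling_op:
  assumes [measurable]: "g \<in> borel_measurable borel" "h \<in> borel_measurable borel"
  shows "kernel_op (coupling_op g h t)"
proof -
  have "kernel_op (\<lambda>F z. \<integral>\<^sup>+ a. F (upd (fst z) t a, upd (snd z) t a) *
        min (cond_density g t (fst z) a) (cond_density h t (snd z) a) \<partial>lborel)"
    by (rule kernel_op_nn_integral) (auto simp: lborel.sigma_finite_measure_axioms borel_prod[symmetric])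
  moreover have "kernel_op (\<lambda>F z. \<integral>\<^sup>+ c. F (upd (fst z) t (fst c), upd (snd z) t (snd c)) *
        residual (cond_density g t (fst z)) (cond_density h t (snd z)) c \<partial>lborel)"
    by (rule kernel_op_nn_integral)
      (auto simp: lborel.sigma_finite_measure_axioms residual_def borel_prod[symmetric])
  ultimately show ?thesis
    unfolding coupling_op_def[abs_def] by (rule kernel_op_sum)
qed

lemmas kernel_op_coupling_ops = kernel_op_foldr[of "coupling_op g h" for g h, OF kernel_op_coupling_op]

text \<open>Overlap plus remainder is the conditional law of one path, so a function
  \<open>G\<close> of that path alone sees only its own kernel. The factor \<open>W\<close> may
  involve both paths outside coordinate \<open>t\<close>. With \<open>W\<close> constant this is the
  marginal property; its generality is what makes bicausality follow.\<close>

lemma coupling_op_mult: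
  assumes [measurable]: "g \<in> borel_measurable borel" "h \<in> borel_measurable borel" "G \<in> borel_measurable borel"
    and W: "\<And>x y a b. W (upd x t a, upd y t b) = W (x, y)"
  shows "coupling_op g h t (\<lambda>z. G (fst z) * W z) = (\<lambda>z. cond_op g t G (fst z) * W z)"
    and "coupling_op g h t (\<lambda>z. G (snd z) * W z) = (\<lambda>z. cond_op h t G (snd z) * W z)"
proof -
  show "coupling_op g h t (\<lambda>z. G (fst z) * W z) = (\<lambda>z. cond_op g t G (fst z) * W z)"
  proof (rule ext, safe)
    fix x y
    define p where "p = cond_density g t x"
    define q where "q = cond_density h t y"
    have [measurable]: "p \<in> borel_measurable borel" "q \<in> borel_measurable borel"
      unfolding p_def q_def by measurable
    have one: "(\<integral>\<^sup>+ a. p a \<partial>lborel) = 1" "(\<integral>\<^sup>+ a. q a \<partial>lborel) = 1"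
      by (simp_all add: p_def q_def)
    have [measurable]: "(\<lambda>c. G (upd x t (fst c))) \<in> borel_measurable (borel :: ('a \<times> 'a) measure)"
      unfolding borel_prod[symmetric] by measurable
    have "coupling_op g h t (\<lambda>z. G (fst z) * W z) (x, y) =
        (\<integral>\<^sup>+ a. W (x, y) * (G (upd x t a) * min (p a) (q a)) \<partial>lborel) +
        (\<integral>\<^sup>+ c. W (x, y) * (G (upd x t (fst c)) * residual p q c) \<partial>lborel)"
      by (simp add: coupling_op_def W p_def q_def ac_simps)
    also have "\<dots> = W (x, y) * ((\<integral>\<^sup>+ a. G (upd x t a) * min (p a) (q a) \<partial>lborel) +
        (\<integral>\<^sup>+ c. G (upd x t (fst c)) * residual p q c \<partial>lborel))"
      by (simp add: nn_integral_cmult distrib_left)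
    also have "(\<integral>\<^sup>+ c. G (upd x t (fst c)) * residual p q c \<partial>lborel) =
        (\<integral>\<^sup>+ a. G (upd x t a) * excess (p a) (q a) \<partial>lborel)"
      by (rule nn_integral_residual(1)[OF _ _ one, of "\<lambda>a. G (upd x t a)"]) auto
    also have "(\<integral>\<^sup>+ a. G (upd x t a) * min (p a) (q a) \<partial>lborel) + \<dots> = cond_op g t G x"
      by (simp add: cond_op_def min_add_excess flip: nn_integral_add distrib_left p_def)
    finally show "coupling_op g h t (\<lambda>z. G (fst z) * W z) (x, y) = cond_op g t G (fst (x, y)) * W (x, y)"
      by (simp add: mult.commute)
  qed
  show "coupling_op g h t (\<lambda>z. G (snd z) * W z) = (\<lambda>z. cond_op h t G (snd z) * W z)"
  proof (rule ext, safe)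
    fix x y
    define p where "p = cond_density g t x"
    define q where "q = cond_density h t y"
    have [measurable]: "p \<in> borel_measurable borel" "q \<in> borel_measurable borel"
      unfolding p_def q_def by measurable
    have one: "(\<integral>\<^sup>+ a. p a \<partial>lborel) = 1" "(\<integral>\<^sup>+ a. q a \<partial>lborel) = 1"
      by (simp_all add: p_def q_def)
    have [measurable]: "(\<lambda>c. G (upd y t (snd c))) \<in> borel_measurable (borel :: ('a \<times> 'a) measure)"
      unfolding borel_prod[symmetric] by measurable
    have "coupling_op g h t (\<lambda>z. G (snd z) * W z) (x, y) =
        (\<integral>\<^sup>+ a. W (x, y) * (G (upd y t a) * min (q a) (p a)) \<partial>lborel) +
        (\<integral>\<^sup>+ c. W (x, y) * (G (upd y t (snd c)) * residual p q c) \<partial>lborel)"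
      by (simp add: coupling_op_def W p_def q_def ac_simps min.commute)
    also have "\<dots> = W (x, y) * ((\<integral>\<^sup>+ a. G (upd y t a) * min (q a) (p a) \<partial>lborel) +
        (\<integral>\<^sup>+ c. G (upd y t (snd c)) * residual p q c \<partial>lborel))"
      by (simp add: nn_integral_cmult distrib_left)
    also have "(\<integral>\<^sup>+ c. G (upd y t (snd c)) * residual p q c \<partial>lborel) =
        (\<integral>\<^sup>+ a. G (upd y t a) * excess (q a) (p a) \<partial>lborel)"
      by (rule nn_integral_residual(2)[OF _ _ one, of "\<lambda>a. G (upd y t a)"]) auto
    also have "(\<integral>\<^sup>+ a. G (upd y t a) * min (q a) (p a) \<partial>lborel) + \<dots> = cond_op h t G y"
      by (simp add: cond_op_def min_add_excess flip: nn_integral_add distrib_left q_def)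
    finally show "coupling_op g h t (\<lambda>z. G (snd z) * W z) (x, y) = cond_op h t G (snd (x, y)) * W (x, y)"
      by (simp add: mult.commute)
  qed
qed

lemma coupling_ops_mult:
  assumes [measurable]: "g \<in> borel_measurable borel" "h \<in> borel_measurable borel" "G \<in> borel_measurable borel"
    and W: "\<And>t x y a b. t \<in> set ts \<Longrightarrow> W (upd x t a, upd y t b) = W (x, y)"
  shows "foldr (coupling_op g h) ts (\<lambda>z. G (fst z) * W z) = (\<lambda>z. foldr (cond_op g) ts G (fst z) * W z)"
    and "foldr (coupling_op g h) ts (\<lambda>z. G (snd z) * W z) = (\<lambda>z. foldr (cond_op h) ts G (snd z) * W z)"
  using W by (induction ts) (simp_all add: coupling_op_mult)

section \<open>A criterion for conditional independence\<close>

text \<open>If the conditional probability of an event about \<open>B\<close> given both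
  \<open>A\<close> and \<open>C\<close> has a version \<phi> that is a function of \<open>C\<close>
  alone, then \<open>A\<close> tells nothing more about \<open>B\<close> once \<open>C\<close> is
  known. Testing on products of events about \<open>A\<close> and \<open>C\<close> is enough. Stated
  with nonnegative integrals, it fits the operators above.\<close>

lemma (in prob_space) cond_indep_varI:
  assumes A [measurable]: "A \<in> M \<rightarrow>\<^sub>M Ma" and B [measurable]: "B \<in> M \<rightarrow>\<^sub>M Mb" and C [measurable]: "C \<in> M \<rightarrow>\<^sub>M Mc"
    and kernel: "\<And>V. V \<in> sets Mb \<Longrightarrow> \<exists>\<phi>\<in>borel_measurable Mc. (\<forall>c. \<phi> c \<le> 1) \<and>
      (\<forall>U\<in>sets Ma. \<forall>D\<in>sets Mc.
        (\<integral>\<^sup>+ \<omega>. indicator V (B \<omega>) * (indicator U (A \<omega>) * indicator D (C \<omega>)) \<partial>M) =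
        (\<integral>\<^sup>+ \<omega>. \<phi> (C \<omega>) * (indicator U (A \<omega>) * indicator D (C \<omega>)) \<partial>M))"
  shows "cond_indep_var Ma A Mb B Mc C"
  unfolding cond_indep_var_def Let_def
proof (intro conjI ballI A B C)
  fix U V assume U[measurable]: "U \<in> sets Ma" and V[measurable]: "V \<in> sets Mb"
  define F where "F = vimage_algebra (space M) C Mc"
  have sets_F: "sets F = {C -` D \<inter> space M | D. D \<in> sets Mc}"
    unfolding F_def using measurable_space[OF C] by (intro sets_vimage_algebra2) auto
  have sub: "subalgebra M F"
  proof -
    have "sets F \<subseteq> sets M" unfolding sets_F by auto
    then show ?thesis by (simp add: subalgebra_def F_def)
  qed
  then interpret finite_measure_subalgebra M F
    by unfold_locales
  obtain \<phi> where \<phi>[measurable]: "\<phi> \<in> borel_measurable Mc" and \<phi>1: "\<And>c. \<phi> c \<le> 1"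
    and \<phi>_eq: "\<And>U D. U \<in> sets Ma \<Longrightarrow> D \<in> sets Mc \<Longrightarrow>
        (\<integral>\<^sup>+ \<omega>. indicator V (B \<omega>) * (indicator U (A \<omega>) * indicator D (C \<omega>)) \<partial>M) =
        (\<integral>\<^sup>+ \<omega>. \<phi> (C \<omega>) * (indicator U (A \<omega>) * indicator D (C \<omega>)) \<partial>M)"
    using kernel[OF V] by blast
  define \<psi> where "\<psi> c = enn2real (\<phi> c)" for c
  have [measurable]: "\<psi> \<in> borel_measurable Mc"
    unfolding \<psi>_def by measurable
  have \<psi>: "ennreal (\<psi> c) = \<phi> c" "0 \<le> \<psi> c" "\<psi> c \<le> 1" for c
  proof -
    have "\<phi> c < \<top>" by (rule order_le_less_trans[OF \<phi>1]) simp
    then show "ennreal (\<psi> c) = \<phi> c" by (simp add: \<psi>_def)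
    then show "\<psi> c \<le> 1" using \<phi>1[of c] by (simp flip: ennreal_le_iff)
  qed (simp add: \<psi>_def)
  have C_F: "C \<in> F \<rightarrow>\<^sub>M Mc"
    unfolding F_def by (rule measurable_vimage_algebra1) (use measurable_space[OF C] in auto)
  have \<psi>C[measurable]: "(\<lambda>\<omega>. \<psi> (C \<omega>)) \<in> borel_measurable F"
    by (rule measurable_compose[OF C_F]) simp
  have int: "integrable M (\<lambda>\<omega>. \<psi> (C \<omega>) * indicator X (A \<omega>))"
    "integrable M (\<lambda>\<omega>. indicator X (A \<omega>) * indicator V (B \<omega>) :: real)" if [measurable]: "X \<in> sets Ma" for X
    using \<psi> by (auto intro!: integrable_const_bound[of _ 1] simp: indicator_def)
  have eq: "AE \<omega> in M. real_cond_exp M F (\<lambda>\<omega>. indicator X (A \<omega>) * indicator V (B \<omega>)) \<omega> =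
      \<psi> (C \<omega>) * real_cond_exp M F (\<lambda>\<omega>. indicator X (A \<omega>)) \<omega>" if X[measurable]: "X \<in> sets Ma" for X
  proof -
    have "AE \<omega> in M. real_cond_exp M F (\<lambda>\<omega>. indicator X (A \<omega>) * indicator V (B \<omega>)) \<omega> =
        real_cond_exp M F (\<lambda>\<omega>. \<psi> (C \<omega>) * indicator X (A \<omega>)) \<omega>"
    proof (rule real_cond_exp_charact)
      fix S assume "S \<in> sets F"
      then obtain D where D[measurable]: "D \<in> sets Mc" and S: "S = C -` D \<inter> space M"
        by (auto simp: sets_F)
      have "(\<integral>\<omega>\<in>S. (indicator X (A \<omega>) * indicator V (B \<omega>) :: real) \<partial>M) =
          (\<integral>\<omega>. indicator V (B \<omega>) * (indicator X (A \<omega>) * indicator D (C \<omega>)) \<partial>M)"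
        unfolding set_lebesgue_integral_def S by (rule Bochner_Integration.integral_cong) (auto simp: indicator_def)
      also have "\<dots> = enn2real (\<integral>\<^sup>+\<omega>. indicator V (B \<omega>) * (indicator X (A \<omega>) * indicator D (C \<omega>)) \<partial>M)"
        by (subst integral_eq_nn_integral)
          (auto simp: ennreal_mult ennreal_indicator intro!: arg_cong[of _ _ enn2real] nn_integral_cong)
      also have "\<dots> = enn2real (\<integral>\<^sup>+\<omega>. ennreal (\<psi> (C \<omega>) * (indicator X (A \<omega>) * indicator D (C \<omega>))) \<partial>M)"
        using \<psi> by (simp add: \<phi>_eq ennreal_mult ennreal_indicator)
      also have "\<dots> = (\<integral>\<omega>. \<psi> (C \<omega>) * (indicator X (A \<omega>) * indicator D (C \<omega>)) \<partial>M)"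
        using \<psi> by (subst integral_eq_nn_integral) auto
      also have "\<dots> = (\<integral>\<omega>\<in>S. \<psi> (C \<omega>) * indicator X (A \<omega>) \<partial>M)"
        unfolding set_lebesgue_integral_def S by (rule Bochner_Integration.integral_cong) (auto simp: indicator_def)
      also have "\<dots> = (\<integral>\<omega>\<in>S. real_cond_exp M F (\<lambda>\<omega>. \<psi> (C \<omega>) * indicator X (A \<omega>)) \<omega> \<partial>M)"
        by (intro real_cond_exp_intA int X \<open>S \<in> sets F\<close>)
      finally show "(\<integral>\<omega>\<in>S. indicator X (A \<omega>) * indicator V (B \<omega>) \<partial>M) =
          (\<integral>\<omega>\<in>S. real_cond_exp M F (\<lambda>\<omega>. \<psi> (C \<omega>) * indicator X (A \<omega>)) \<omega> \<partial>M)" .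
    qed (use int real_cond_exp_int(1) in auto)
    moreover have "AE \<omega> in M. real_cond_exp M F (\<lambda>\<omega>. \<psi> (C \<omega>) * indicator X (A \<omega>)) \<omega> =
        \<psi> (C \<omega>) * real_cond_exp M F (\<lambda>\<omega>. indicator X (A \<omega>)) \<omega>"
      by (rule real_cond_exp_mult) (use int in auto)
    ultimately show ?thesis by eventually_elim simp
  qed
  \<comment> \<open>With the whole space in place of \<open>X\<close>, \<open>eq\<close> identifies
    \<open>\<psi> (C \<omega>)\<close> as the conditional probability of \<open>V\<close>; inserting
    this into \<open>eq\<close> for \<open>U\<close> gives the product formula.\<close>
  have "AE \<omega> in M. real_cond_exp M F (\<lambda>\<omega>. indicator (space Ma) (A \<omega>)) \<omega> = 1"
  proof -
    have "AE \<omega> in M. real_cond_exp M F (\<lambda>\<omega>. indicator (space Ma) (A \<omega>)) \<omega> = real_cond_exp M F (\<lambda>_. 1) \<omega>"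
      by (rule real_cond_exp_cong) (auto simp: measurable_space[OF A])
    moreover have "AE \<omega> in M. real_cond_exp M F (\<lambda>_. 1) \<omega> = 1"
      by (rule real_cond_exp_F_meas) auto
    ultimately show ?thesis by eventually_elim simp
  qed
  moreover have "AE \<omega> in M. real_cond_exp M F (\<lambda>\<omega>. indicator (space Ma) (A \<omega>) * indicator V (B \<omega>)) \<omega> =
      real_cond_exp M F (\<lambda>\<omega>. indicator V (B \<omega>)) \<omega>"
    by (rule real_cond_exp_cong) (auto simp: measurable_space[OF A])
  ultimately have "AE \<omega> in M. real_cond_exp M F (\<lambda>\<omega>. indicator V (B \<omega>)) \<omega> = \<psi> (C \<omega>)"
    using eq[OF sets.top] by eventually_elim simp
  with eq[OF U] show "AE \<omega> in M. real_cond_exp M (vimage_algebra (space M) C Mc) (\<lambda>\<omega>. indicator U (A \<omega>) * indicator V (B \<omega>)) \<omega> =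
      real_cond_exp M (vimage_algebra (space M) C Mc) (\<lambda>\<omega>. indicator U (A \<omega>)) \<omega> *
      real_cond_exp M (vimage_algebra (space M) C Mc) (\<lambda>\<omega>. indicator V (B \<omega>)) \<omega>"
    unfolding F_def by eventually_elim simp
qed

section \<open>Bicausality\<close>

lemma cond_ops_one:
  assumes "g \<in> borel_measurable borel"
  shows "foldr (cond_op g) ts (\<lambda>_. 1) = (\<lambda>_. 1)"
  by (induction ts) (simp_all add: cond_op_def[abs_def] assms)

lemma cond_ops_le_1:
  assumes "g \<in> borel_measurable borel" "F \<in> borel_measurable borel" "\<And>x. F x \<le> 1"
  shows "foldr (cond_op g) ts F x \<le> 1"
  using kernel_op_mono[OF kernel_op_cond_ops[OF assms(1)], of F "\<lambda>_. 1" ts x] assms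
  by (simp add: cond_ops_one)

lemma sorted_list_of_set_atMost_append:
  "sorted_list_of_set {..t} @ sorted_list_of_set {t<..} = sorted_list_of_set (UNIV :: 't::{finite, linorder} set)"
  by (rule sorted_distinct_set_unique) (auto simp: sorted_append)

text \<open>Padding with zeros lets a function of full paths that depends only on the coordinates in
  \<open>I\<close> be read as a measurable function of the tuple of these coordinates.\<close>

lemma measurable_extend_coords:
  "(\<lambda>c. \<chi> s. if s \<in> I then c s else 0) \<in> coords_algebra I \<rightarrow>\<^sub>M (borel :: (real ^ 'd::finite ^ 't::finite) measure)"
proof (subst borel_measurable_euclidean_space, rule ballI)
  fix i :: "real ^ 'd ^ 't" assume "i \<in> Basis"
  then obtain s b where i: "i = axis s b" by (auto simp: Basis_vec_def)
  show "(\<lambda>c. (\<chi> s. if s \<in> I then c s else 0) \<bullet> i) \<in> borel_measurable (coords_algebra I)"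
    unfolding i inner_axis coords_algebra_def by (cases "s \<in> I") simp_all
qed

lemma coords_upd: "t \<notin> I \<Longrightarrow> coords I (upd x t a) = coords I x"
  by (auto simp: coords_def restrict_def)

text \<open>The starting point of the iteration is irrelevant because every coordinate is overwritten.\<close>

locale stepwise_coupling =
  fixes g h :: "('d::finite, 't::{finite, linorder}) path_space \<Rightarrow> ennreal"
    and \<pi> :: "(('d, 't) path_space \<times> ('d, 't) path_space) measure"
  assumes meas [measurable]: "g \<in> borel_measurable borel" "h \<in> borel_measurable borel"
    and one: "(\<integral>\<^sup>+ x. g x \<partial>lborel) = 1" "(\<integral>\<^sup>+ x. h x \<partial>lborel) = 1"
    and sets_borel: "sets \<pi> = sets borel"
    and nn_integral_eq: "F \<in> borel_measurable borel \<Longrightarrow> (\<integral>\<^sup>+ z. F z \<partial>\<pi>) =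
      foldr (coupling_op g h) (sorted_list_of_set UNIV) F (\<chi> s. undefined, \<chi> s. undefined)"
begin

lemma sets_pair [measurable_cong]: "sets \<pi> = sets (borel \<Otimes>\<^sub>M borel)"
  by (simp only: sets_borel borel_prod)

lemma nn_integral_marginal:
  assumes [measurable]: "G \<in> borel_measurable borel"
  shows "(\<integral>\<^sup>+ z. G (fst z) \<partial>\<pi>) = (\<integral>\<^sup>+ x. g x * G x \<partial>lborel)"
    and "(\<integral>\<^sup>+ z. G (snd z) \<partial>\<pi>) = (\<integral>\<^sup>+ x. h x * G x \<partial>lborel)"
proof -
  have m: "(\<lambda>z :: ('d, 't) path_space \<times> ('d, 't) path_space. G (fst z)) \<in> borel_measurable borel"
    "(\<lambda>z :: ('d, 't) path_space \<times> ('d, 't) path_space. G (snd z)) \<in> borel_measurable borel"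
    unfolding borel_prod[symmetric] by measurable
  show "(\<integral>\<^sup>+ z. G (fst z) \<partial>\<pi>) = (\<integral>\<^sup>+ x. g x * G x \<partial>lborel)"
    using coupling_ops_mult(1)[of g h G "sorted_list_of_set UNIV" "\<lambda>_. 1"]
    by (simp add: nn_integral_eq m cond_ops_eq_nn_integral one)
  show "(\<integral>\<^sup>+ z. G (snd z) \<partial>\<pi>) = (\<integral>\<^sup>+ x. h x * G x \<partial>lborel)"
    using coupling_ops_mult(2)[of g h G "sorted_list_of_set UNIV" "\<lambda>_. 1"]
    by (simp add: nn_integral_eq m cond_ops_eq_nn_integral one)
qed

lemma in_couplings: "\<pi> \<in> couplings (density lborel g) (density lborel h)"
proof -
  have "emeasure \<pi> (space \<pi>) = 1"
    using nn_integral_marginal(1)[of "\<lambda>_. 1"] one by simp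
  moreover have "distr \<pi> borel fst = density lborel g"
  proof (rule measure_eqI)
    fix A assume "A \<in> sets (distr \<pi> borel fst)"
    then have [measurable]: "A \<in> sets borel" by simp
    have "emeasure (distr \<pi> borel fst) A = (\<integral>\<^sup>+ z. indicator A (fst z) \<partial>\<pi>)"
      by (simp flip: nn_integral_indicator add: nn_integral_distr)
    then show "emeasure (distr \<pi> borel fst) A = emeasure (density lborel g) A"
      by (simp add: nn_integral_marginal emeasure_density)
  qed simp
  moreover have "distr \<pi> borel snd = density lborel h"
  proof (rule measure_eqI)
    fix A assume "A \<in> sets (distr \<pi> borel snd)"
    then have [measurable]: "A \<in> sets borel" by simp
    have "emeasure (distr \<pi> borel snd) A = (\<integral>\<^sup>+ z. indicator A (snd z) \<partial>\<pi>)"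
      by (simp flip: nn_integral_indicator add: nn_integral_distr)
    then show "emeasure (distr \<pi> borel snd) A = emeasure (density lborel h) A"
      by (simp add: nn_integral_marginal emeasure_density)
  qed simp
  ultimately show ?thesis
    by (auto simp: couplings_def sets_pair intro: prob_spaceI)
qed

text \<open>The steps have total mass 1, so a function blind to the coordinates being drawn is left
  unchanged.\<close>

lemma foldr_coupling_op_invariant:
  assumes "\<And>t x y a b. t \<in> set bs \<Longrightarrow> W (upd x t a, upd y t b) = W (x, y)"
  shows "foldr (coupling_op g h) bs W = W"
  using coupling_ops_mult(1)[of g h "\<lambda>_. 1" bs W] assms by (simp add: cond_ops_one)

text \<open>The tower property. After the steps in \<open>bs\<close> both integrands have become the
  same function: on the left \<open>G\<close> turns into its iterated conditional expectation, and
  on the right that expectation is already fixed, since it depends on the times in \<open>as\<close>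
  only.\<close>

lemma nn_integral_cond_ops:
  assumes [measurable]: "G \<in> borel_measurable borel" "W \<in> borel_measurable borel"
    and times: "as @ bs = sorted_list_of_set UNIV"
    and W: "\<And>t x y a b. t \<in> set bs \<Longrightarrow> W (upd x t a, upd y t b) = W (x, y)"
  shows "(\<integral>\<^sup>+ z. G (fst z) * W z \<partial>\<pi>) = (\<integral>\<^sup>+ z. foldr (cond_op g) bs G (fst z) * W z \<partial>\<pi>)"
    and "(\<integral>\<^sup>+ z. G (snd z) * W z \<partial>\<pi>) = (\<integral>\<^sup>+ z. foldr (cond_op h) bs G (snd z) * W z \<partial>\<pi>)"
proof -
  have "set as \<inter> set bs = {}"
    using distinct_sorted_list_of_set[of "UNIV :: 't set"] times by (metis distinct_append)
  then have inv: "foldr (cond_op f) bs G (upd x t a) = foldr (cond_op f) bs G x" if "t \<in> set bs" for f x t a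
    by (rule_tac depends_onD[OF depends_on_cond_ops[OF times]]) (use that in auto)
  have m [measurable]: "W \<in> borel_measurable (borel \<Otimes>\<^sub>M borel)"
    unfolding borel_prod by measurable
  have *: "(\<lambda>z. F (fst z) * W z) \<in> borel_measurable borel" "(\<lambda>z. F (snd z) * W z) \<in> borel_measurable borel"
    if [measurable]: "F \<in> borel_measurable borel" for F
    unfolding borel_prod[symmetric] by measurable
  show "(\<integral>\<^sup>+ z. G (fst z) * W z \<partial>\<pi>) = (\<integral>\<^sup>+ z. foldr (cond_op g) bs G (fst z) * W z \<partial>\<pi>)"
    using foldr_coupling_op_invariant[of bs "\<lambda>z. foldr (cond_op g) bs G (fst z) * W z"] W
    by (simp add: nn_integral_eq * coupling_ops_mult inv flip: times)
  show "(\<integral>\<^sup>+ z. G (snd z) * W z \<partial>\<pi>) = (\<integral>\<^sup>+ z. foldr (cond_op h) bs G (snd z) * W z \<partial>\<pi>)"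
    using foldr_coupling_op_invariant[of bs "\<lambda>z. foldr (cond_op h) bs G (snd z) * W z"] W
    by (simp add: nn_integral_eq * coupling_ops_mult inv flip: times)
qed

text \<open>The conditional probability of a future event, as a function of the tuple of past
  coordinates: the iterated operator depends on times up to \<open>t\<close> only, so the later
  coordinates of its argument may be filled with zeros.\<close>

lemma cond_kernel:
  fixes V :: "('t \<Rightarrow> real ^ 'd) set"
  assumes V: "V \<in> sets (coords_algebra {t<..})" and [measurable]: "f \<in> borel_measurable borel"
  obtains \<phi> where "\<phi> \<in> borel_measurable (coords_algebra {..t})" "\<And>c. \<phi> c \<le> 1"
    "\<And>x. \<phi> (coords {..t} x) =
      foldr (cond_op f) (sorted_list_of_set {t<..}) (\<lambda>x. indicator V (coords {t<..} x)) x"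
proof -
  let ?G = "\<lambda>x :: ('d, 't) path_space. indicator V (coords {t<..} x) :: ennreal"
  have G[measurable]: "?G \<in> borel_measurable borel"
    by (rule measurable_compose[OF measurable_coords borel_measurable_indicator[OF V]])
  define \<phi> where "\<phi> c = foldr (cond_op f) (sorted_list_of_set {t<..}) ?G (\<chi> s. if s \<in> {..t} then c s else 0)" for c
  have "depends_on {..t} (foldr (cond_op f) (sorted_list_of_set {t<..}) ?G)"
    using depends_on_cond_ops[OF sorted_list_of_set_atMost_append[of t], of f ?G] by simp
  then have "\<phi> (coords {..t} x) = foldr (cond_op f) (sorted_list_of_set {t<..}) ?G x" for x
    unfolding \<phi>_def by (rule depends_onD) (simp add: coords_def)
  moreover have "\<phi> c \<le> 1" for c
    unfolding \<phi>_def by (intro cond_ops_le_1 G assms(2)) (simp add: indicator_def)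
  moreover have "\<phi> \<in> borel_measurable (coords_algebra {..t})"
    unfolding \<phi>_def by (rule measurable_compose[OF measurable_extend_coords]) measurable
  ultimately show ?thesis using that by blast
qed

text \<open>In the tower property \<open>W\<close> is taken to be an event about both pasts up to
  \<open>t\<close>, while the conditional expectation of one path's future is a function of its own
  past. This is the hypothesis of \<open>cond_indep_varI\<close>.\<close>

lemma in_bicausal_couplings: "\<pi> \<in> bicausal_couplings (density lborel g) (density lborel h)"
proof -
  have prob: "prob_space \<pi>"
    using in_couplings by (simp add: couplings_def)
  note c[measurable] = measurable_coords
  have "prob_space.cond_indep_var \<pi>
      (coords_algebra {..t}) (\<lambda>z. coords {..t} (snd z))
      (coords_algebra {t<..}) (\<lambda>z. coords {t<..} (fst z))
      (coords_algebra {..t}) (\<lambda>z. coords {..t} (fst z))" for t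
  proof (rule prob_space.cond_indep_varI[OF prob])
    fix V :: "('t \<Rightarrow> real ^ 'd) set" assume V[measurable]: "V \<in> sets (coords_algebra {t<..})"
    obtain \<phi> where \<phi>: "\<phi> \<in> borel_measurable (coords_algebra {..t})" "\<And>c. \<phi> c \<le> 1"
      "\<And>x. \<phi> (coords {..t} x) =
        foldr (cond_op g) (sorted_list_of_set {t<..}) (\<lambda>x. indicator V (coords {t<..} x)) x"
      using cond_kernel[OF V meas(1)] by blast
    have "(\<integral>\<^sup>+ z. indicator V (coords {t<..} (fst z)) *
          (indicator U (coords {..t} (snd z)) * indicator D (coords {..t} (fst z))) \<partial>\<pi>) =
        (\<integral>\<^sup>+ z. \<phi> (coords {..t} (fst z)) *
          (indicator U (coords {..t} (snd z)) * indicator D (coords {..t} (fst z))) \<partial>\<pi>)"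
      if [measurable]: "U \<in> sets (coords_algebra {..t})" "D \<in> sets (coords_algebra {..t})" for U D
      unfolding \<phi>(3)
      by (rule nn_integral_cond_ops(1)[OF _ _ sorted_list_of_set_atMost_append])
        (auto simp: coords_upd borel_prod[symmetric])
    with \<phi>(1,2) show "\<exists>\<phi>\<in>borel_measurable (coords_algebra {..t}). (\<forall>c. \<phi> c \<le> 1) \<and>
      (\<forall>U\<in>sets (coords_algebra {..t}). \<forall>D\<in>sets (coords_algebra {..t}).
        (\<integral>\<^sup>+ z. indicator V (coords {t<..} (fst z)) *
          (indicator U (coords {..t} (snd z)) * indicator D (coords {..t} (fst z))) \<partial>\<pi>) =
        (\<integral>\<^sup>+ z. \<phi> (coords {..t} (fst z)) *
          (indicator U (coords {..t} (snd z)) * indicator D (coords {..t} (fst z))) \<partial>\<pi>))"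
      by blast
  qed measurable
  moreover have "prob_space.cond_indep_var \<pi>
      (coords_algebra {..t}) (\<lambda>z. coords {..t} (fst z))
      (coords_algebra {t<..}) (\<lambda>z. coords {t<..} (snd z))
      (coords_algebra {..t}) (\<lambda>z. coords {..t} (snd z))" for t
  proof (rule prob_space.cond_indep_varI[OF prob])
    fix V :: "('t \<Rightarrow> real ^ 'd) set" assume V[measurable]: "V \<in> sets (coords_algebra {t<..})"
    obtain \<phi> where \<phi>: "\<phi> \<in> borel_measurable (coords_algebra {..t})" "\<And>c. \<phi> c \<le> 1"
      "\<And>x. \<phi> (coords {..t} x) =
        foldr (cond_op h) (sorted_list_of_set {t<..}) (\<lambda>x. indicator V (coords {t<..} x)) x"
      using cond_kernel[OF V meas(2)] by blast
    have "(\<integral>\<^sup>+ z. indicator V (coords {t<..} (snd z)) *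
          (indicator U (coords {..t} (fst z)) * indicator D (coords {..t} (snd z))) \<partial>\<pi>) =
        (\<integral>\<^sup>+ z. \<phi> (coords {..t} (snd z)) *
          (indicator U (coords {..t} (fst z)) * indicator D (coords {..t} (snd z))) \<partial>\<pi>)"
      if [measurable]: "U \<in> sets (coords_algebra {..t})" "D \<in> sets (coords_algebra {..t})" for U D
      unfolding \<phi>(3)
      by (rule nn_integral_cond_ops(2)[OF _ _ sorted_list_of_set_atMost_append])
        (auto simp: coords_upd borel_prod[symmetric])
    with \<phi>(1,2) show "\<exists>\<phi>\<in>borel_measurable (coords_algebra {..t}). (\<forall>c. \<phi> c \<le> 1) \<and>
      (\<forall>U\<in>sets (coords_algebra {..t}). \<forall>D\<in>sets (coords_algebra {..t}).
        (\<integral>\<^sup>+ z. indicator V (coords {t<..} (snd z)) *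
          (indicator U (coords {..t} (fst z)) * indicator D (coords {..t} (snd z))) \<partial>\<pi>) =
        (\<integral>\<^sup>+ z. \<phi> (coords {..t} (snd z)) *
          (indicator U (coords {..t} (fst z)) * indicator D (coords {..t} (snd z))) \<partial>\<pi>))"
      by blast
  qed measurable
  ultimately show ?thesis
    using in_couplings by (simp add: bicausal_couplings_def case_prod_beta')
qed

end

lemma stepwise_coupling_exists:
  fixes g h :: "('d::finite, 't::{finite, linorder}) path_space \<Rightarrow> ennreal"
  assumes "g \<in> borel_measurable borel" "h \<in> borel_measurable borel"
    and "(\<integral>\<^sup>+ x. g x \<partial>lborel) = 1" "(\<integral>\<^sup>+ x. h x \<partial>lborel) = 1"
  obtains \<pi> where "stepwise_coupling g h \<pi>"
  using kernel_op_measure[OF kernel_op_coupling_ops[OF assms(1,2)]] assms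
  unfolding stepwise_coupling_def by metis

section \<open>The probability of separation\<close>

lemma ennreal_le_diff_add: "(a::ennreal) \<le> (a - b) + b"
  by (cases "b \<le> a") (auto simp: diff_add_cancel_ennreal not_le intro: add_increasing less_imp_le)

lemma ennreal_diff_leI: "(a::ennreal) \<le> b + c \<Longrightarrow> c \<noteq> \<top> \<Longrightarrow> a - c \<le> b"
  by (simp add: ennreal_minus_le_iff add.commute)

context stepwise_coupling
begin

definition step_defect :: "'t \<Rightarrow> ('d, 't) path_space \<Rightarrow> ennreal" where
  "step_defect t x = defect (cond_density g t x) (cond_density h t x)"

lemma step_defect_measurable [measurable]: "step_defect t \<in> borel_measurable borel"
  unfolding step_defect_def[abs_def] by measurable

lemma step_defect_cong: "(\<And>s. s < t \<Longrightarrow> x $ s = y $ s) \<Longrightarrow> step_defect t x = step_defect t y"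
  unfolding step_defect_def using cond_density_cong[of t x y g] cond_density_cong[of t x y h] by presburger

definition first_diff :: "'t \<Rightarrow> ('d, 't) path_space \<times> ('d, 't) path_space \<Rightarrow> ennreal" where
  "first_diff t z = indicator {z. (\<forall>s<t. fst z $ s = snd z $ s) \<and> fst z $ t \<noteq> snd z $ t} z"

lemma first_diff_measurable: "first_diff t \<in> borel_measurable borel"
proof -
  have "closed {z :: ('d, 't) path_space \<times> ('d, 't) path_space. \<forall>s<t. fst z $ s = snd z $ s}"
    "closed {z :: ('d, 't) path_space \<times> ('d, 't) path_space. fst z $ t = snd z $ t}"
    by (intro closed_Collect_all closed_Collect_imp closed_Collect_eq open_Collect_const continuous_intros)+
  then have "{z. (\<forall>s<t. fst z $ s = snd z $ s)} - {z. fst z $ t = snd z $ t}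
      \<in> sets (borel :: (('d, 't) path_space \<times> ('d, 't) path_space) measure)"
    by (intro sets.Diff borel_closed)
  also have "{z. (\<forall>s<t. fst z $ s = snd z $ s)} - {z. fst z $ t = snd z $ t} =
      {z :: ('d, 't) path_space \<times> ('d, 't) path_space. (\<forall>s<t. fst z $ s = snd z $ s) \<and> fst z $ t \<noteq> snd z $ t}"
    by auto
  finally show ?thesis
    unfolding first_diff_def[abs_def] by simp
qed

text \<open>If the pasts differ, \<open>t\<close> cannot be the first time of difference. If they
  agree, both conditional laws are taken at the same past, the diagonal part does not contribute,
  and the residual has mass equal to the defect.\<close>

lemma coupling_op_first_diff: "coupling_op g h t (first_diff t) z \<le> step_defect t (fst z)"
proof (cases "\<forall>s<t. fst z $ s = snd z $ s")
  case False
  then have "first_diff t (upd (fst z) t a, upd (snd z) t b) = 0" for a b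
    by (auto simp: first_diff_def indicator_def)
  then show ?thesis by (simp add: coupling_op_def)
next
  case True
  then have eq: "cond_density h t (snd z) = cond_density h t (fst z)"
    by (auto intro!: cond_density_cong simp: fun_eq_iff)
  let ?p = "cond_density g t (fst z)" and ?q = "cond_density h t (fst z)"
  have "first_diff t (upd (fst z) t a, upd (snd z) t a) = 0" for a
    by (simp add: first_diff_def)
  then have "coupling_op g h t (first_diff t) z =
      (\<integral>\<^sup>+ c. first_diff t (upd (fst z) t (fst c), upd (snd z) t (snd c)) * residual ?p ?q c \<partial>lborel)"
    by (simp add: coupling_op_def eq)
  also have "\<dots> \<le> (\<integral>\<^sup>+ c. 1 * residual ?p ?q c \<partial>lborel)"
    by (intro nn_integral_mono mult_right_mono) (auto simp: first_diff_def indicator_def)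
  also have "\<dots> = (\<integral>\<^sup>+ a. 1 * excess (?p a) (?q a) \<partial>lborel)"
    by (rule nn_integral_residual(1)[where G = "\<lambda>_. 1"]) auto
  also have "\<dots> = step_defect t (fst z)"
    by (simp add: step_defect_def defect_def)
  finally show ?thesis .
qed

lemma times_split: "sorted_list_of_set {..<t} @ t # sorted_list_of_set {t<..} = sorted_list_of_set (UNIV :: 't set)"
  by (rule sorted_distinct_set_unique) (auto simp: sorted_append)

lemma nn_integral_first_diff: "(\<integral>\<^sup>+ z. first_diff t z \<partial>\<pi>) \<le> (\<integral>\<^sup>+ x. g x * step_defect t x \<partial>lborel)"
proof -
  let ?as = "sorted_list_of_set {..<t}" and ?bs = "sorted_list_of_set {t<..}"
  let ?u = "(\<chi> s. undefined, \<chi> s. undefined) :: ('d, 't) path_space \<times> ('d, 't) path_space"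
  let ?D = "\<lambda>z :: ('d, 't) path_space \<times> ('d, 't) path_space. step_defect t (fst z)"
  have D: "?D \<in> borel_measurable borel"
    unfolding borel_prod[symmetric] by measurable
  have inv: "foldr (coupling_op g h) ?bs (first_diff t) = first_diff t"
  proof (rule foldr_coupling_op_invariant)
    fix t' and x y :: "('d, 't) path_space" and a b
    assume "t' \<in> set ?bs"
    then have "upd x t' a $ s = x $ s" "upd y t' b $ s = y $ s" if "s \<le> t" for s
      using that by auto
    then show "first_diff t (upd x t' a, upd y t' b) = first_diff t (x, y)"
      by (simp add: first_diff_def indicator_def del: upd_nth)
  qed
  \<comment> \<open>The bound at time \<open>t\<close> sees only the strict past, so the steps from
    \<open>t\<close> on may be put back. The expression is then an integral against \<pi> of a
    function of the first path, hence an integral against \<open>g\<close>.\<close>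
  have inv': "foldr (coupling_op g h) (t # ?bs) ?D = ?D"
  proof (rule foldr_coupling_op_invariant)
    fix t' and x y :: "('d, 't) path_space" and a b
    assume "t' \<in> set (t # ?bs)"
    then have "step_defect t (upd x t' a) = step_defect t x"
      by (intro step_defect_cong) auto
    then show "?D (upd x t' a, upd y t' b) = ?D (x, y)" by simp
  qed
  have "(\<integral>\<^sup>+ z. first_diff t z \<partial>\<pi>) = foldr (coupling_op g h) ?as (coupling_op g h t (first_diff t)) ?u"
    by (simp add: nn_integral_eq first_diff_measurable inv flip: times_split[of t])
  also have "\<dots> \<le> foldr (coupling_op g h) ?as ?D ?u"
    by (intro kernel_op_mono[OF kernel_op_coupling_ops] kernel_op_measurable[OF kernel_op_coupling_op]
        first_diff_measurable D coupling_op_first_diff meas)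
  also have "\<dots> = (\<integral>\<^sup>+ z. ?D z \<partial>\<pi>)"
    using inv' by (simp add: nn_integral_eq D flip: times_split[of t])
  also have "\<dots> = (\<integral>\<^sup>+ x. g x * step_defect t x \<partial>lborel)"
    by (rule nn_integral_marginal) measurable
  finally show ?thesis .
qed

lemma marginal_density_le:
  assumes [measurable]: "f \<in> borel_measurable borel" "f' \<in> borel_measurable borel"
  shows "marginal_density f t x \<le> marginal_density (\<lambda>x. f x - f' x) t x + marginal_density f' t x"
proof -
  have "marginal_density f t x \<le> marginal_density (\<lambda>x. (f x - f' x) + f' x) t x"
    unfolding marginal_density_def
    by (intro kernel_op_mono[OF kernel_op_coord_ints] ennreal_le_diff_add) measurable
  also have "\<dots> = marginal_density (\<lambda>x. f x - f' x) t x + marginal_density f' t x"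
    unfolding marginal_density_def by (intro kernel_op_add[OF kernel_op_coord_ints]) measurable
  finally show ?thesis .
qed

lemma coord_int_AE_finite:
  assumes [measurable]: "f \<in> borel_measurable borel" and "coord_int t (marginal_density f t) x \<noteq> \<top>"
  shows "AE a in lborel. marginal_density f t (upd x t a) \<noteq> \<top>"
  using nn_integral_noteq_infinite[of "\<lambda>a. marginal_density f t (upd x t a)" lborel] assms(2)
  by (simp add: coord_int_def)

text \<open>Write \<open>p\<close> and \<open>q\<close> for the conditional densities and
  \<open>G\<close>, \<open>H\<close> for the densities up to \<open>t\<close>, so that
  \<open>G = N p\<close> and \<open>H = N' q\<close>. Multiplying by \<open>N\<close> removes the
  quotient: N times the positive part of p - q is the positive part of G - N q. Replacing N q by H =
  N' q costs (N' - N) q, which integrates to N' - N as \<open>q\<close> has mass 1. Both G - H and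
  N' - N are bounded by marginals of the positive parts of g - h and h - g.\<close>

lemma coord_int_mult_step_defect:
  fixes x t
  defines "N \<equiv> coord_int t (marginal_density g t) x" and "N' \<equiv> coord_int t (marginal_density h t) x"
  assumes fin: "N \<noteq> \<top>" "N' \<noteq> \<top>"
  shows "step_defect t x * N \<le>
    coord_int t (marginal_density (\<lambda>x. g x - h x) t) x + coord_int t (marginal_density (\<lambda>x. h x - g x) t) x"
proof (cases "N = 0")
  case False
  let ?p = "cond_density g t x" and ?q = "cond_density h t x"
  let ?G = "\<lambda>a. marginal_density g t (upd x t a)" and ?H = "\<lambda>a. marginal_density h t (upd x t a)"
  let ?D = "\<lambda>a. marginal_density (\<lambda>x. g x - h x) t (upd x t a)"
  have G: "AE a in lborel. ?G a \<noteq> \<top>"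
    using fin coord_int_AE_finite[of g] by (simp add: N_def)
  have q: "AE a in lborel. ?q a \<noteq> \<top>"
    using nn_integral_noteq_infinite[of ?q lborel] by simp
  \<comment> \<open>For \<open>N' = 0\<close> the law \<open>?q\<close> is the fallback; the
    identity survives almost everywhere because \<open>?H\<close> is then a null function.\<close>
  have H: "AE a in lborel. ?H a = N' * ?q a"
  proof (cases "N' = 0")
    case True
    then have "AE a in lborel. ?H a = 0"
      by (simp add: N'_def coord_int_def nn_integral_0_iff_AE)
    with True show ?thesis by simp
  next
    case False
    then have "N' * (m / N') = m" for m
      using fin by (simp add: ennreal_times_divide mult.commute[of N'] ennreal_mult_divide_eq)
    with False fin show ?thesis by (simp add: cond_density_def N'_def)
  qed
  have Np: "N * ?p a = ?G a" for a
  proof -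
    have "N * (m / N) = m" for m
      using False fin by (simp add: ennreal_times_divide mult.commute[of N] ennreal_mult_divide_eq)
    with False fin show ?thesis by (simp add: cond_density_def N_def)
  qed
  have "step_defect t x * N = (\<integral>\<^sup>+ a. N * excess (?p a) (?q a) \<partial>lborel)"
    by (simp add: step_defect_def defect_def nn_integral_cmult mult.commute)
  also have "\<dots> \<le> (\<integral>\<^sup>+ a. ?D a + (N' - N) * ?q a \<partial>lborel)"
  proof (rule nn_integral_mono_AE)
    show "AE a in lborel. N * excess (?p a) (?q a) \<le> ?D a + (N' - N) * ?q a"
      using G q H
    proof eventually_elim
      case (elim a)
      have "?p a \<noteq> \<top>"
        using elim(1) Np[of a] False by (auto simp: ennreal_mult_eq_top_iff)
      then have eq: "N * excess (?p a) (?q a) = ?G a - N * ?q a"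
        using fin by (simp add: excess_le_diff ennreal_right_diff_distrib Np)
      have "?G a \<le> ?D a + N' * ?q a"
        using marginal_density_le[OF meas, of t "upd x t a"] unfolding elim(3) .
      \<comment> \<open>The difference is truncated at 0, so either of \<open>N\<close> and
        \<open>N'\<close> may be the larger one.\<close>
      also have "N' * ?q a \<le> ((N' - N) + N) * ?q a"
        by (intro mult_right_mono ennreal_le_diff_add) simp
      finally have "?G a \<le> ?D a + (N' - N) * ?q a + N * ?q a"
        by (simp add: distrib_right ac_simps add_left_mono)
      then show "N * excess (?p a) (?q a) \<le> ?D a + (N' - N) * ?q a"
        unfolding eq using fin elim(2) by (intro ennreal_diff_leI) (auto simp: ennreal_mult_eq_top_iff)
    qed
  qed
  also have "\<dots> = coord_int t (marginal_density (\<lambda>x. g x - h x) t) x + (N' - N)"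
    by (simp add: nn_integral_add nn_integral_cmult coord_int_def)
  also have "N' - N \<le> coord_int t (marginal_density (\<lambda>x. h x - g x) t) x"
  proof (rule ennreal_diff_leI)
    have "N' \<le> coord_int t (\<lambda>x. marginal_density (\<lambda>x. h x - g x) t x + marginal_density g t x) x"
      unfolding N'_def
      by (intro kernel_op_mono[OF kernel_op_coord_int] marginal_density_le meas) measurable
    then show "N' \<le> coord_int t (marginal_density (\<lambda>x. h x - g x) t) x + N"
      unfolding N_def by (subst (asm) kernel_op_add[OF kernel_op_coord_int]) measurable
  qed (rule fin)
  finally show ?thesis by (simp add: add_left_mono)
qed simp

text \<open>A function of the strict past moves out of the integrals over \<open>t\<close> and later
  times. The estimate at a fixed past is then integrated over the earlier coordinates; pasts with
  infinite marginals are null for the representing measure \<open>M\<close>.\<close>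

lemma nn_integral_step_defect:
  "(\<integral>\<^sup>+ x. g x * step_defect t x \<partial>lborel) \<le> (\<integral>\<^sup>+ x. g x - h x \<partial>lborel) + (\<integral>\<^sup>+ x. h x - g x \<partial>lborel)"
proof -
  let ?as = "sorted_list_of_set {..<t}" and ?bs = "sorted_list_of_set {t<..}"
  have lborel: "(\<integral>\<^sup>+ x. F x \<partial>lborel) = foldr coord_int ?as (coord_int t (marginal_density F t)) (\<chi> s. undefined)"
    if "F \<in> borel_measurable borel" for F :: "('d, 't) path_space \<Rightarrow> ennreal"
  proof -
    have "foldr coord_int (sorted_list_of_set UNIV) F (\<chi> s. undefined) = (\<integral>\<^sup>+ x. F x \<partial>lborel)"
      by (rule foldr_coord_int_eq_nn_integral) (use that in simp_all)
    then show ?thesis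
      by (simp add: marginal_density_def flip: times_split[of t])
  qed
  obtain M where M: "sets M = sets borel"
    "\<And>F :: ('d, 't) path_space \<Rightarrow> ennreal. F \<in> borel_measurable borel \<Longrightarrow> foldr coord_int ?as F (\<chi> s. undefined) = (\<integral>\<^sup>+ w. F w \<partial>M)"
    using kernel_op_measure[OF kernel_op_coord_ints] by blast
  note [measurable_cong] = M(1)
  have fin: "AE x in M. coord_int t (marginal_density f t) x \<noteq> \<top>"
    if [measurable]: "f \<in> borel_measurable borel" and "(\<integral>\<^sup>+ x. f x \<partial>lborel) = 1" for f
  proof -
    have "(\<integral>\<^sup>+ x. coord_int t (marginal_density f t) x \<partial>M) \<noteq> \<infinity>"
      using lborel[of f] that by (simp add: M)
    then show ?thesis
      using nn_integral_noteq_infinite[of _ M] by simp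
  qed
  have "depends_on (- set (t # ?bs)) (step_defect t)"
    by (auto simp: depends_on_def intro!: step_defect_cong)
  from coord_ints_mult_left[OF meas(1) this]
  have "coord_int t (marginal_density (\<lambda>x. step_defect t x * g x) t) =
      (\<lambda>x. step_defect t x * coord_int t (marginal_density g t) x)"
    by (simp add: marginal_density_def fun_eq_iff)
  then have "(\<integral>\<^sup>+ x. g x * step_defect t x \<partial>lborel) =
      (\<integral>\<^sup>+ x. step_defect t x * coord_int t (marginal_density g t) x \<partial>M)"
    using lborel[of "\<lambda>x. step_defect t x * g x"] by (simp add: M mult.commute)
  also have "\<dots> \<le> (\<integral>\<^sup>+ x. coord_int t (marginal_density (\<lambda>x. g x - h x) t) x +
      coord_int t (marginal_density (\<lambda>x. h x - g x) t) x \<partial>M)"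
    using fin[OF meas(1) one(1)] fin[OF meas(2) one(2)]
  proof (intro nn_integral_mono_AE, eventually_elim)
    case (elim x)
    show ?case by (rule coord_int_mult_step_defect[OF elim(3,4)])
  qed
  also have "\<dots> = (\<integral>\<^sup>+ x. g x - h x \<partial>lborel) + (\<integral>\<^sup>+ x. h x - g x \<partial>lborel)"
    by (simp add: nn_integral_add lborel M)
  finally show ?thesis .
qed

lemma nn_integral_neq_le:
  "(\<integral>\<^sup>+ z. indicator {z. fst z \<noteq> snd z} z \<partial>\<pi>) \<le>
    of_nat CARD('t) * ((\<integral>\<^sup>+ x. g x - h x \<partial>lborel) + (\<integral>\<^sup>+ x. h x - g x \<partial>lborel))"
proof -
  have ex: "\<exists>t. (\<forall>s<t. x $ s = y $ s) \<and> x $ t \<noteq> y $ t" if "x \<noteq> y" for x y :: "('d, 't) path_space"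
  proof -
    let ?S = "{t. x $ t \<noteq> y $ t}"
    have "?S \<noteq> {}" using that by (auto simp: vec_eq_iff)
    then have "Min ?S \<in> ?S" by (intro Min_in) simp_all
    moreover have "s \<notin> ?S" if "s < Min ?S" for s
      using that Min_le[of ?S s] by (meson finite leD)
    ultimately show ?thesis by (intro exI[of _ "Min ?S"]) blast
  qed
  have "indicator {z. fst z \<noteq> snd z} z \<le> (\<Sum>t\<in>UNIV. first_diff t z)"
    for z :: "('d, 't) path_space \<times> ('d, 't) path_space"
  proof (cases "fst z = snd z")
    case False
    then obtain t where "(\<forall>s<t. fst z $ s = snd z $ s) \<and> fst z $ t \<noteq> snd z $ t"
      using ex by blast
    then have "first_diff t z = 1"
      by (simp add: first_diff_def)
    then show ?thesis
      using member_le_sum[of t UNIV "\<lambda>t. first_diff t z"] False by simp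
  qed simp
  then have "(\<integral>\<^sup>+ z. indicator {z. fst z \<noteq> snd z} z \<partial>\<pi>) \<le> (\<integral>\<^sup>+ z. (\<Sum>t\<in>UNIV. first_diff t z) \<partial>\<pi>)"
    by (intro nn_integral_mono)
  also have "\<dots> = (\<Sum>t\<in>UNIV. \<integral>\<^sup>+ z. first_diff t z \<partial>\<pi>)"
    using first_diff_measurable sets_borel by (intro nn_integral_sum) (simp cong: measurable_cong_sets)
  also have "\<dots> \<le> (\<Sum>t\<in>(UNIV::'t set). (\<integral>\<^sup>+ x. g x - h x \<partial>lborel) + (\<integral>\<^sup>+ x. h x - g x \<partial>lborel))"
    by (intro sum_mono order_trans[OF nn_integral_first_diff nn_integral_step_defect])
  finally show ?thesis by simp
qed

end

section \<open>Smoothing\<close>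

text \<open>The increment is the integral of the directional derivative along the segment from
  \<open>z\<close> to \<open>z + v\<close>. Cauchy-Schwarz bounds the integrand, and after
  exchanging the integrals translation invariance removes the dependence on the position in the
  segment.\<close>

lemma nn_integral_increment_le:
  fixes f :: "'a::euclidean_space \<Rightarrow> real"
  assumes deriv: "\<And>x. GDERIV f x :> grad x" and cont: "continuous_on UNIV grad"
  shows "(\<integral>\<^sup>+ z. ennreal \<bar>f (z + v) - f z\<bar> \<partial>lborel) \<le> ennreal (norm v) * (\<integral>\<^sup>+ z. ennreal (norm (grad z)) \<partial>lborel)"
proof -
  have [measurable]: "grad \<in> borel_measurable borel"
    using cont by (rule borel_measurable_continuous_onI)
  have grad_line: "continuous_on A (\<lambda>s. grad (z + s *\<^sub>R v))" for A :: "real set" and z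
    by (intro continuous_on_compose2[OF cont] continuous_intros) auto
  have "ennreal \<bar>f (z + v) - f z\<bar> \<le>
      (\<integral>\<^sup>+ s. indicator {0..1} s * (ennreal (norm v) * ennreal (norm (grad (z + s *\<^sub>R v)))) \<partial>lborel)" for z
  proof -
    have "((\<lambda>s. f (z + s *\<^sub>R v)) has_vector_derivative v \<bullet> grad (z + s *\<^sub>R v)) (at s within {0..1})" for s
    proof -
      have "((\<lambda>s. z + s *\<^sub>R v) has_derivative (\<lambda>h. h *\<^sub>R v)) (at s within {0..1})"
        by (auto intro!: derivative_eq_intros)
      from has_derivative_compose[OF this deriv[unfolded gderiv_def]]
      show ?thesis by (simp add: has_vector_derivative_def)
    qed
    moreover have c: "continuous_on {0..1} (\<lambda>s. v \<bullet> grad (z + s *\<^sub>R v))"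
      by (intro continuous_intros grad_line)
    ultimately have "has_bochner_integral lborel (\<lambda>s. indicator {0..1} s *\<^sub>R (v \<bullet> grad (z + s *\<^sub>R v)))
        (f (z + 1 *\<^sub>R v) - f (z + 0 *\<^sub>R v))"
      by (intro has_bochner_integral_FTC_Icc) auto
    then have "ennreal \<bar>f (z + v) - f z\<bar> \<le>
        (\<integral>\<^sup>+ s. ennreal (norm (indicator {0..1} s *\<^sub>R (v \<bullet> grad (z + s *\<^sub>R v)))) \<partial>lborel)"
      using has_bochner_integral_norm_bound by fastforce
    also have "\<dots> \<le> (\<integral>\<^sup>+ s. indicator {0..1} s * (ennreal (norm v) * ennreal (norm (grad (z + s *\<^sub>R v)))) \<partial>lborel)"
      using Cauchy_Schwarz_ineq2[of v]
      by (intro nn_integral_mono) (auto simp: indicator_def simp flip: ennreal_mult)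
    finally show ?thesis .
  qed
  then have "(\<integral>\<^sup>+ z. ennreal \<bar>f (z + v) - f z\<bar> \<partial>lborel) \<le>
      (\<integral>\<^sup>+ z. \<integral>\<^sup>+ s. indicator {0..1} s * (ennreal (norm v) * ennreal (norm (grad (z + s *\<^sub>R v)))) \<partial>lborel \<partial>lborel)"
    by (intro nn_integral_mono)
  also have "\<dots> = (\<integral>\<^sup>+ s. \<integral>\<^sup>+ z. indicator {0..1} s * (ennreal (norm v) * ennreal (norm (grad (z + s *\<^sub>R v)))) \<partial>lborel \<partial>lborel)"
    by (rule lborel_pair.Fubini') measurable
  also have "\<dots> = (\<integral>\<^sup>+ s. indicator {0..1::real} s * (ennreal (norm v) * (\<integral>\<^sup>+ z. ennreal (norm (grad z)) \<partial>lborel)) \<partial>lborel)"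
  proof (rule nn_integral_cong)
    fix s :: real
    have "(\<integral>\<^sup>+ z. ennreal (norm (grad (z + s *\<^sub>R v))) \<partial>lborel) = (\<integral>\<^sup>+ z. ennreal (norm (grad z)) \<partial>distr lborel borel ((+) (s *\<^sub>R v)))"
      by (subst nn_integral_distr) (simp_all add: add.commute)
    then show "(\<integral>\<^sup>+ z. indicator {0..1} s * (ennreal (norm v) * ennreal (norm (grad (z + s *\<^sub>R v)))) \<partial>lborel) =
        indicator {0..1} s * (ennreal (norm v) * (\<integral>\<^sup>+ z. ennreal (norm (grad z)) \<partial>lborel))"
      by (simp add: nn_integral_cmult lborel_distr_plus)
  qed
  also have "\<dots> = ennreal (norm v) * (\<integral>\<^sup>+ z. ennreal (norm (grad z)) \<partial>lborel)"
    by (simp add: nn_integral_multc)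
  finally show ?thesis .
qed

text \<open>For \<sigma> > 0, the density at \<open>w\<close> of y + \<sigma> Z when Z has density
  \<open>f\<close>; the power of \<sigma> is the Jacobian.\<close>

definition noise_kernel :: "('a::euclidean_space \<Rightarrow> real) \<Rightarrow> real \<Rightarrow> 'a \<Rightarrow> 'a \<Rightarrow> real" where
  "noise_kernel f \<sigma> y w = f ((w - y) /\<^sub>R \<sigma>) / \<sigma> ^ DIM('a)"

lemma noise_kernel_measurable [measurable]:
  assumes [measurable]: "f \<in> borel_measurable borel" "X \<in> borel_measurable M" "Y \<in> borel_measurable M"
  shows "(\<lambda>u. noise_kernel f \<sigma> (X u) (Y u)) \<in> borel_measurable M"
  unfolding noise_kernel_def by measurable

lemma nn_integral_lborel_affine:
  fixes F :: "'a::euclidean_space \<Rightarrow> ennreal"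
  assumes [measurable]: "F \<in> borel_measurable borel" and "0 < \<sigma>"
  shows "(\<integral>\<^sup>+ w. F w \<partial>lborel) = (\<integral>\<^sup>+ z. ennreal (\<sigma> ^ DIM('a)) * F (y + \<sigma> *\<^sub>R z) \<partial>lborel)"
  using assms(2)
  by (subst lborel_affine[of \<sigma> y]) (simp_all add: nn_integral_density nn_integral_distr)

lemma smoothed_eq_density:
  fixes f :: "'a::ordered_euclidean_space \<Rightarrow> real"
  assumes \<xi>: "prob_space \<xi>" "\<xi> = density lborel (\<lambda>x. ennreal (f x))" and f[measurable]: "f \<in> borel_measurable borel"
    and \<mu>: "prob_space \<mu>" "sets \<mu> = sets borel" and "0 < \<sigma>"
  shows "smoothed \<xi> \<sigma> \<mu> = density lborel (\<lambda>w. \<integral>\<^sup>+ y. ennreal (noise_kernel f \<sigma> y w) \<partial>\<mu>)"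
proof (rule measure_eqI)
  interpret \<mu>: prob_space \<mu> by fact
  interpret \<mu>l: pair_sigma_finite \<mu> lborel ..
  note [measurable_cong] = \<mu>(2)
  have [measurable_cong]: "sets \<xi> = sets borel"
    by (simp add: \<xi>(2))
  fix A assume "A \<in> sets (smoothed \<xi> \<sigma> \<mu>)"
  then have [measurable]: "A \<in> sets borel" by (simp add: smoothed_def)
  have fin: "finite_measure \<mu>" "finite_measure (scaled_noise \<xi> \<sigma>)"
    using \<mu>.finite_measure_axioms prob_space.prob_space_distr[OF \<xi>(1), of "\<lambda>z. \<sigma> *\<^sub>R z" borel]
    by (auto simp: scaled_noise_def prob_space_def)
  have "emeasure (smoothed \<xi> \<sigma> \<mu>) A = (\<integral>\<^sup>+ w. indicator A w \<partial>smoothed \<xi> \<sigma> \<mu>)"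
    by (simp add: smoothed_def)
  also have "\<dots> = (\<integral>\<^sup>+ y. \<integral>\<^sup>+ z. indicator A (y + z) \<partial>scaled_noise \<xi> \<sigma> \<partial>\<mu>)"
    unfolding smoothed_def using fin \<mu>(2)
    by (intro nn_integral_convolution) (simp_all add: scaled_noise_def)
  also have "\<dots> = (\<integral>\<^sup>+ y. \<integral>\<^sup>+ z. ennreal (f z) * indicator A (y + \<sigma> *\<^sub>R z) \<partial>lborel \<partial>\<mu>)"
    unfolding scaled_noise_def by (simp add: nn_integral_distr) (simp add: \<xi>(2) nn_integral_density)
  also have "\<dots> = (\<integral>\<^sup>+ y. \<integral>\<^sup>+ w. ennreal (noise_kernel f \<sigma> y w) * indicator A w \<partial>lborel \<partial>\<mu>)"
  proof (rule nn_integral_cong)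
    fix y
    have "ennreal (\<sigma> ^ DIM('a)) * (ennreal (noise_kernel f \<sigma> y (y + \<sigma> *\<^sub>R z)) * c) = ennreal (f z) * c" for z c
      unfolding mult.assoc[symmetric] using \<open>0 < \<sigma>\<close> by (simp add: noise_kernel_def flip: ennreal_mult')
    then show "(\<integral>\<^sup>+ z. ennreal (f z) * indicator A (y + \<sigma> *\<^sub>R z) \<partial>lborel) =
        (\<integral>\<^sup>+ w. ennreal (noise_kernel f \<sigma> y w) * indicator A w \<partial>lborel)"
      by (subst (2) nn_integral_lborel_affine[OF _ \<open>0 < \<sigma>\<close>, of _ y]) simp_all
  qed
  also have "\<dots> = (\<integral>\<^sup>+ w. \<integral>\<^sup>+ y. ennreal (noise_kernel f \<sigma> y w) * indicator A w \<partial>\<mu> \<partial>lborel)"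
    by (rule \<mu>l.Fubini'[symmetric]) measurable
  also have "\<dots> = emeasure (density lborel (\<lambda>w. \<integral>\<^sup>+ y. ennreal (noise_kernel f \<sigma> y w) \<partial>\<mu>)) A"
    by (simp add: emeasure_density nn_integral_multc)
  finally show "emeasure (smoothed \<xi> \<sigma> \<mu>) A =
      emeasure (density lborel (\<lambda>w. \<integral>\<^sup>+ y. ennreal (noise_kernel f \<sigma> y w) \<partial>\<mu>)) A" .
qed (simp add: smoothed_def)

text \<open>Substituting w = x + \<sigma> z cancels the Jacobian and turns the difference into an
  increment of \<open>f\<close> by (x - y) / \<sigma>. This is the origin of the factor 1 /
  \<sigma>.\<close>

lemma nn_integral_noise_kernel_diff:
  fixes f :: "'a::euclidean_space \<Rightarrow> real"
  assumes deriv: "\<And>x. GDERIV f x :> grad x" and cont: "continuous_on UNIV grad"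
    and f[measurable]: "f \<in> borel_measurable borel" and "0 < \<sigma>"
  shows "(\<integral>\<^sup>+ w. ennreal \<bar>noise_kernel f \<sigma> x w - noise_kernel f \<sigma> y w\<bar> \<partial>lborel) \<le>
    ennreal (norm (x - y) / \<sigma>) * (\<integral>\<^sup>+ z. ennreal (norm (grad z)) \<partial>lborel)"
proof -
  have "ennreal (\<sigma> ^ DIM('a)) * ennreal \<bar>noise_kernel f \<sigma> x (x + \<sigma> *\<^sub>R z) - noise_kernel f \<sigma> y (x + \<sigma> *\<^sub>R z)\<bar> =
      ennreal \<bar>f (z + (x - y) /\<^sub>R \<sigma>) - f z\<bar>" for z
  proof -
    have "(x + \<sigma> *\<^sub>R z - y) /\<^sub>R \<sigma> = z + (x - y) /\<^sub>R \<sigma>"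
      using \<open>0 < \<sigma>\<close> by (simp add: algebra_simps)
    then have "noise_kernel f \<sigma> x (x + \<sigma> *\<^sub>R z) - noise_kernel f \<sigma> y (x + \<sigma> *\<^sub>R z) =
        (f z - f (z + (x - y) /\<^sub>R \<sigma>)) / \<sigma> ^ DIM('a)"
      using \<open>0 < \<sigma>\<close> by (simp add: noise_kernel_def diff_divide_distrib)
    then show ?thesis
      using \<open>0 < \<sigma>\<close> by (simp add: abs_minus_commute flip: ennreal_mult')
  qed
  then have "(\<integral>\<^sup>+ w. ennreal \<bar>noise_kernel f \<sigma> x w - noise_kernel f \<sigma> y w\<bar> \<partial>lborel) =
      (\<integral>\<^sup>+ z. ennreal \<bar>f (z + (x - y) /\<^sub>R \<sigma>) - f z\<bar> \<partial>lborel)"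
    by (subst nn_integral_lborel_affine[OF _ \<open>0 < \<sigma>\<close>, of _ x]) simp_all
  then show ?thesis
    using nn_integral_increment_le[OF deriv cont, of "(x - y) /\<^sub>R \<sigma>"] \<open>0 < \<sigma>\<close>
    by (simp add: divide_inverse mult.commute)
qed

lemma ennreal_diff_add_diff:
  assumes "0 \<le> a" "0 \<le> b"
  shows "(ennreal a - ennreal b) + (ennreal b - ennreal a) = ennreal \<bar>a - b\<bar>"
  using assms by (cases "a \<le> b") (simp_all add: ennreal_minus ennreal_neg)

lemma nn_integral_diff_le:
  assumes [measurable]: "u \<in> borel_measurable M" "v \<in> borel_measurable M" and "(\<integral>\<^sup>+ z. v z \<partial>M) \<noteq> \<top>"
  shows "(\<integral>\<^sup>+ z. u z \<partial>M) - (\<integral>\<^sup>+ z. v z \<partial>M) \<le> (\<integral>\<^sup>+ z. u z - v z \<partial>M)"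
proof (rule ennreal_diff_leI[OF _ assms(3)])
  have "(\<integral>\<^sup>+ z. u z \<partial>M) \<le> (\<integral>\<^sup>+ z. (u z - v z) + v z \<partial>M)"
    by (intro nn_integral_mono ennreal_le_diff_add)
  then show "(\<integral>\<^sup>+ z. u z \<partial>M) \<le> (\<integral>\<^sup>+ z. u z - v z \<partial>M) + (\<integral>\<^sup>+ z. v z \<partial>M)"
    by (simp add: nn_integral_add)
qed

text \<open>Any coupling of the unsmoothed laws writes both densities as averages over the same
  pairs, so their difference is an average of differences of noise kernels centred at the two points
  of a pair.\<close>

lemma total_variation_smoothed_le:
  fixes f :: "'a::euclidean_space \<Rightarrow> real" and \<mu> \<nu> :: "'a measure" and \<sigma> :: real
  defines "g \<equiv> \<lambda>w. \<integral>\<^sup>+ y. ennreal (noise_kernel f \<sigma> y w) \<partial>\<mu>"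
    and "h \<equiv> \<lambda>w. \<integral>\<^sup>+ y. ennreal (noise_kernel f \<sigma> y w) \<partial>\<nu>"
  assumes deriv: "\<And>x. GDERIV f x :> grad x" and cont: "continuous_on UNIV grad"
    and f[measurable]: "f \<in> borel_measurable borel" and f0: "\<And>x. 0 \<le> f x" and \<sigma>: "0 < \<sigma>"
    and \<pi>: "\<pi> \<in> couplings \<mu> \<nu>"
    and fin: "(\<integral>\<^sup>+ w. g w \<partial>lborel) \<noteq> \<top>" "(\<integral>\<^sup>+ w. h w \<partial>lborel) \<noteq> \<top>"
  shows "(\<integral>\<^sup>+ w. g w - h w \<partial>lborel) + (\<integral>\<^sup>+ w. h w - g w \<partial>lborel) \<le>
    (\<integral>\<^sup>+ z. ennreal (norm (grad z)) \<partial>lborel) * ((\<integral>\<^sup>+ z. ennreal (norm (fst z - snd z)) \<partial>\<pi>) / ennreal \<sigma>)"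
proof -
  interpret \<pi>: prob_space \<pi> using \<pi> by (simp add: couplings_def)
  interpret \<pi>l: pair_sigma_finite \<pi> lborel ..
  have [measurable_cong]: "sets \<pi> = sets (borel \<Otimes>\<^sub>M borel)"
    and \<mu>: "\<mu> = distr \<pi> borel fst" and \<nu>: "\<nu> = distr \<pi> borel snd"
    using \<pi> by (auto simp: couplings_def)
  have g: "g w = (\<integral>\<^sup>+ z. ennreal (noise_kernel f \<sigma> (fst z) w) \<partial>\<pi>)"
    and h: "h w = (\<integral>\<^sup>+ z. ennreal (noise_kernel f \<sigma> (snd z) w) \<partial>\<pi>)" for w
    by (simp_all add: g_def h_def \<mu> \<nu> nn_integral_distr)
  have [measurable]: "g \<in> borel_measurable lborel" "h \<in> borel_measurable lborel"
    unfolding g h by measurable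
  have k0: "0 \<le> noise_kernel f \<sigma> y w" for y w
    using f0 \<sigma> by (simp add: noise_kernel_def)
  have "(\<integral>\<^sup>+ w. g w - h w \<partial>lborel) + (\<integral>\<^sup>+ w. h w - g w \<partial>lborel) =
      (\<integral>\<^sup>+ w. (g w - h w) + (h w - g w) \<partial>lborel)"
    by (simp add: nn_integral_add)
  also have "\<dots> \<le> (\<integral>\<^sup>+ w. \<integral>\<^sup>+ z. ennreal \<bar>noise_kernel f \<sigma> (fst z) w - noise_kernel f \<sigma> (snd z) w\<bar> \<partial>\<pi> \<partial>lborel)"
  proof (rule nn_integral_mono_AE)
    \<comment> \<open>Finiteness at \<open>w\<close> is what allows the difference of two integrals
      to be bounded by the integral of the difference in \<open>ennreal\<close>.\<close>
    have "AE w in lborel. g w \<noteq> \<top>" "AE w in lborel. h w \<noteq> \<top>"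
      using nn_integral_noteq_infinite[of g lborel] nn_integral_noteq_infinite[of h lborel] fin by simp_all
    then show "AE w in lborel. (g w - h w) + (h w - g w) \<le>
        (\<integral>\<^sup>+ z. ennreal \<bar>noise_kernel f \<sigma> (fst z) w - noise_kernel f \<sigma> (snd z) w\<bar> \<partial>\<pi>)"
    proof eventually_elim
      case (elim w)
      let ?u = "\<lambda>z. ennreal (noise_kernel f \<sigma> (fst z) w)" and ?v = "\<lambda>z. ennreal (noise_kernel f \<sigma> (snd z) w)"
      have "(g w - h w) + (h w - g w) \<le> (\<integral>\<^sup>+ z. ?u z - ?v z \<partial>\<pi>) + (\<integral>\<^sup>+ z. ?v z - ?u z \<partial>\<pi>)"
        using elim unfolding g h by (intro add_mono nn_integral_diff_le) measurable
      also have "\<dots> = (\<integral>\<^sup>+ z. (?u z - ?v z) + (?v z - ?u z) \<partial>\<pi>)"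
        by (rule nn_integral_add[symmetric]) measurable
      finally show ?case by (simp add: ennreal_diff_add_diff k0)
    qed
  qed
  also have "\<dots> = (\<integral>\<^sup>+ z. \<integral>\<^sup>+ w. ennreal \<bar>noise_kernel f \<sigma> (fst z) w - noise_kernel f \<sigma> (snd z) w\<bar> \<partial>lborel \<partial>\<pi>)"
    by (rule \<pi>l.Fubini') measurable
  also have "\<dots> \<le> (\<integral>\<^sup>+ z. ennreal (norm (fst z - snd z) / \<sigma>) * (\<integral>\<^sup>+ z. ennreal (norm (grad z)) \<partial>lborel) \<partial>\<pi>)"
    by (intro nn_integral_mono nn_integral_noise_kernel_diff[OF deriv cont f \<sigma>])
  also have "\<dots> = (\<integral>\<^sup>+ z. ennreal (norm (fst z - snd z)) / ennreal \<sigma> \<partial>\<pi>) * (\<integral>\<^sup>+ z. ennreal (norm (grad z)) \<partial>lborel)"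
    using \<sigma> by (simp add: nn_integral_multc divide_ennreal)
  also have "\<dots> = (\<integral>\<^sup>+ z. ennreal (norm (grad z)) \<partial>lborel) * ((\<integral>\<^sup>+ z. ennreal (norm (fst z - snd z)) \<partial>\<pi>) / ennreal \<sigma>)"
    by (simp add: nn_integral_divide mult.commute)
  finally show ?thesis .
qed

section \<open>The transport cost\<close>

text \<open>Convexity of the power at the midpoint of \<open>a\<close> and \<open>b\<close>;
  arguments equal to 0 are treated directly.\<close>

lemma powr_add_le:
  fixes a b p :: real
  assumes "1 \<le> p" "0 \<le> a" "0 \<le> b"
  shows "(a + b) powr p \<le> 2 powr (p - 1) * (a powr p + b powr p)"
proof (cases "a = 0 \<or> b = 0")
  case True
  have "1 \<le> 2 powr (p - 1)" using assms(1) by (simp add: ge_one_powr_ge_zero)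
  with True show ?thesis
    using assms by (auto intro!: mult_right_mono[of 1 _ "_ powr p", simplified])
next
  case False
  with assms have pos: "0 < a" "0 < b" by auto
  have "((1 - 1/2) *\<^sub>R a + (1/2) *\<^sub>R b) powr p \<le> (1 - 1/2) * a powr p + (1/2) * b powr p"
    using pos by (intro convex_onD[OF powr_convex[OF assms(1)]]) auto
  then have "((a + b) / 2) powr p \<le> (a powr p + b powr p) / 2"
    by (simp add: field_simps)
  then show ?thesis
    using pos by (simp add: powr_divide powr_diff field_simps)
qed

lemma epowr_1 [simp]: "epowr x 1 = x"
  by (cases x) (simp_all add: epowr_def)

lemma epowr_epowr_inverse: "0 < p \<Longrightarrow> epowr (epowr x (1 / p)) p = x"
  by (cases x) (simp_all add: epowr_def powr_powr)

lemma couplings_nonempty: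
  assumes \<mu>: "prob_space \<mu>" "sets \<mu> = sets borel" and \<nu>: "prob_space \<nu>" "sets \<nu> = sets borel"
  shows "\<mu> \<Otimes>\<^sub>M \<nu> \<in> couplings \<mu> \<nu>"
proof -
  interpret \<mu>: prob_space \<mu> by fact
  interpret \<nu>: prob_space \<nu> by fact
  interpret pair_prob_space \<mu> \<nu> ..
  have space: "space \<mu> = UNIV" "space \<nu> = UNIV"
    using sets_eq_imp_space_eq[OF \<mu>(2)] sets_eq_imp_space_eq[OF \<nu>(2)] by auto
  have "distr (\<mu> \<Otimes>\<^sub>M \<nu>) borel fst = \<mu>"
  proof (rule measure_eqI)
    fix A assume "A \<in> sets (distr (\<mu> \<Otimes>\<^sub>M \<nu>) borel fst)"
    then have A: "A \<in> sets \<mu>" by (simp add: \<mu>(2))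
    have "fst -` A \<inter> space (\<mu> \<Otimes>\<^sub>M \<nu>) = A \<times> space \<nu>"
      by (auto simp: space_pair_measure space)
    then show "emeasure (distr (\<mu> \<Otimes>\<^sub>M \<nu>) borel fst) A = emeasure \<mu> A"
      using A by (subst emeasure_distr)
        (simp_all add: \<nu>.emeasure_pair_measure_Times \<nu>.emeasure_space_1 \<mu>(2) measurable_cong_sets[OF refl \<mu>(2)[symmetric]])
  qed (simp add: \<mu>)
  moreover have "distr (\<mu> \<Otimes>\<^sub>M \<nu>) borel snd = \<nu>"
  proof (rule measure_eqI)
    fix A assume "A \<in> sets (distr (\<mu> \<Otimes>\<^sub>M \<nu>) borel snd)"
    then have A: "A \<in> sets \<nu>" by (simp add: \<nu>(2))
    have "snd -` A \<inter> space (\<mu> \<Otimes>\<^sub>M \<nu>) = space \<mu> \<times> A"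
      by (auto simp: space_pair_measure space)
    then show "emeasure (distr (\<mu> \<Otimes>\<^sub>M \<nu>) borel snd) A = emeasure \<nu> A"
      using A by (subst emeasure_distr)
        (simp_all add: \<nu>.emeasure_pair_measure_Times \<mu>.emeasure_space_1 \<nu>(2) measurable_cong_sets[OF refl \<nu>(2)[symmetric]])
  qed (simp add: \<nu>)
  ultimately show ?thesis
    using prob_space_axioms by (simp add: couplings_def \<mu>(2) \<nu>(2) cong: sets_pair_measure_cong)
qed

lemma wasserstein_1: "wasserstein 1 \<mu> \<nu> = (INF \<pi>\<in>couplings \<mu> \<nu>. \<integral>\<^sup>+ z. ennreal (norm (fst z - snd z)) \<partial>\<pi>)"
  by (simp add: wasserstein_def case_prod_beta')

text \<open>For positive \<open>G\<close>, multiplying by \<sigma> / G moves the constants to the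
  other side, so that the infimum can be taken. For \<open>G = 0\<close> a single coupling forces
  \<open>D = 0\<close>, and this is where one must exist.\<close>

lemma le_mult_wasserstein_1:
  assumes le: "\<And>\<pi>. \<pi> \<in> couplings \<mu> \<nu> \<Longrightarrow>
      D \<le> ennreal G * ((\<integral>\<^sup>+ z. ennreal (norm (fst z - snd z)) \<partial>\<pi>) / ennreal \<sigma>)"
    and "couplings \<mu> \<nu> \<noteq> {}" "0 \<le> G" "0 < \<sigma>"
  shows "D \<le> ennreal G * (wasserstein 1 \<mu> \<nu> / ennreal \<sigma>)"
proof (cases "G = 0")
  case True
  then show ?thesis using assms by fastforce
next
  case False
  with \<open>0 \<le> G\<close> have G: "0 < G" by simp
  have cancel: "ennreal (\<sigma> / G) * (ennreal G * (I / ennreal \<sigma>)) = I"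
    "ennreal G * ((ennreal (\<sigma> / G) * I) / ennreal \<sigma>) = I" for I
  proof -
    have "ennreal (\<sigma> / G) * (ennreal G * (I / ennreal \<sigma>)) = (ennreal (\<sigma> / G) * ennreal G) * I / ennreal \<sigma>"
      by (simp add: ennreal_times_divide mult.assoc)
    also have "ennreal (\<sigma> / G) * ennreal G = ennreal \<sigma>"
      using G \<open>0 < \<sigma>\<close> by (simp flip: ennreal_mult')
    finally show 1: "ennreal (\<sigma> / G) * (ennreal G * (I / ennreal \<sigma>)) = I"
      using \<open>0 < \<sigma>\<close> by (simp add: mult.commute[of "ennreal \<sigma>"] ennreal_mult_divide_eq)
    have "ennreal G * ((ennreal (\<sigma> / G) * I) / ennreal \<sigma>) = ennreal (\<sigma> / G) * (ennreal G * (I / ennreal \<sigma>))"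
      by (simp add: ennreal_times_divide mult.left_commute)
    with 1 show "ennreal G * ((ennreal (\<sigma> / G) * I) / ennreal \<sigma>) = I" by simp
  qed
  have "ennreal (\<sigma> / G) * D \<le> wasserstein 1 \<mu> \<nu>"
    unfolding wasserstein_1
  proof (rule INF_greatest)
    fix \<pi> assume "\<pi> \<in> couplings \<mu> \<nu>"
    from mult_left_mono[OF le[OF this], of "ennreal (\<sigma> / G)"]
    show "ennreal (\<sigma> / G) * D \<le> (\<integral>\<^sup>+ z. ennreal (norm (fst z - snd z)) \<partial>\<pi>)"
      by (simp add: cancel(1))
  qed
  then have "ennreal G * ((ennreal (\<sigma> / G) * D) / ennreal \<sigma>) \<le> ennreal G * (wasserstein 1 \<mu> \<nu> / ennreal \<sigma>)"
    by (intro mult_left_mono divide_right_mono_ennreal) auto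
  then show ?thesis by (simp add: cancel(2))
qed

text \<open>Each of the T summands is compared with the full norms of both paths, whence the factor
  T. Each norm power is at most \<open>R powr p\<close> plus its tail, whence 2
  \<open>R powr p\<close>. The restriction to distinct paths is kept on the constant only; the tails
  can afford to lose it.\<close>

lemma path_cost_le:
  fixes x y :: "('d::finite, 't::{finite, linorder}) path_space"
  assumes "1 \<le> p" "0 < R"
  defines "tail \<equiv> \<lambda>x :: ('d, 't) path_space. ennreal (norm x powr p) * indicator {x. R \<le> norm x} x"
  shows "ennreal (\<Sum>t\<in>UNIV. norm (x $ t - y $ t) powr p) \<le>
    ennreal (2 powr (p - 1) * real CARD('t)) *
      (ennreal (2 * R powr p) * indicator {z. fst z \<noteq> snd z} (x, y) + (tail x + tail y))"
proof (cases "x = y")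
  case False
  have t: "norm (z :: ('d, 't) path_space) powr p \<le> R powr p + norm z powr p * indicator {x. R \<le> norm x} z" for z
    using assms by (auto simp: indicator_def intro!: powr_mono2)
  have "norm (x $ t - y $ t) powr p \<le> 2 powr (p - 1) * (norm x powr p + norm y powr p)" for t
  proof -
    have "norm (x $ t - y $ t) \<le> norm x + norm y"
      by (rule order_trans[OF norm_triangle_ineq4 add_mono[OF Finite_Cartesian_Product.norm_nth_le Finite_Cartesian_Product.norm_nth_le]])
    then have "norm (x $ t - y $ t) powr p \<le> (norm x + norm y) powr p"
      using assms(1) by (intro powr_mono2) auto
    also have "\<dots> \<le> 2 powr (p - 1) * (norm x powr p + norm y powr p)"
      using assms(1) by (intro powr_add_le) auto
    finally show ?thesis .
  qed
  then have "(\<Sum>t\<in>(UNIV::'t set). norm (x $ t - y $ t) powr p) \<le>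
      (\<Sum>t\<in>(UNIV::'t set). 2 powr (p - 1) * (norm x powr p + norm y powr p))"
    by (rule sum_mono)
  also have "\<dots> = 2 powr (p - 1) * real CARD('t) * (norm x powr p + norm y powr p)"
    by simp
  also have "\<dots> \<le> 2 powr (p - 1) * real CARD('t) *
      (2 * R powr p + (norm x powr p * indicator {x. R \<le> norm x} x + norm y powr p * indicator {x. R \<le> norm x} y))"
    using t[of x] t[of y] by (intro mult_left_mono) auto
  finally have "ennreal (\<Sum>t\<in>UNIV. norm (x $ t - y $ t) powr p) \<le> ennreal (2 powr (p - 1) * real CARD('t) *
      (2 * R powr p + (norm x powr p * indicator {x. R \<le> norm x} x + norm y powr p * indicator {x. R \<le> norm x} y)))"
    by (rule ennreal_leI)
  then show ?thesis
    using False by (simp add: tail_def ennreal_mult ennreal_plus ennreal_indicator)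
qed simp

text \<open>One factor T comes from the coordinates in the cost and stays outside. The 2 from the
  two norms and the second T from the possible separation times are absorbed by 2^T, which also
  dominates the coefficient 1 of the tails. The coupling argument yields 2^(p-1), which is enlarged
  to 6^(p-1).\<close>

lemma constant_le:
  assumes "1 \<le> p" "0 < R"
  shows "ennreal (2 powr (p - 1) * real CARD('t)) * (ennreal (2 * R powr p) * (of_nat CARD('t) * D) + B) \<le>
    ennreal (6 powr (p - 1) * real CARD('t::finite) * 2 ^ CARD('t)) * (ennreal (R powr p) * D + B)"
proof -
  let ?T = "CARD('t)"
  have T: "2 * ?T \<le> 2 ^ ?T"
  proof (cases ?T)
    case (Suc n)
    have "Suc n \<le> 2 ^ n" by (rule Suc_leI[OF less_exp])
    then show ?thesis using Suc by simp
  qed simp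
  have "ennreal (2 * R powr p) * (of_nat ?T * D) = ennreal (2 * R powr p) * ennreal (real ?T) * D"
    by (simp add: mult.assoc ennreal_of_nat_eq_real_of_nat)
  also have "\<dots> = of_nat (2 * ?T) * (ennreal (R powr p) * D)"
    by (simp add: ennreal_of_nat_eq_real_of_nat mult.assoc mult.left_commute flip: ennreal_mult' mult.assoc)
  also have "\<dots> \<le> of_nat (2 ^ ?T) * (ennreal (R powr p) * D)"
    using T by (intro mult_right_mono of_nat_mono) auto
  finally have 1: "ennreal (2 * R powr p) * (of_nat ?T * D) \<le> of_nat (2 ^ ?T) * (ennreal (R powr p) * D)" .
  have "1 * B \<le> of_nat (2 ^ ?T) * B"
    using of_nat_mono[of 1 "2 ^ ?T", where 'a = ennreal] by (intro mult_right_mono) simp_all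
  with 1 have "ennreal (2 * R powr p) * (of_nat ?T * D) + B \<le> of_nat (2 ^ ?T) * (ennreal (R powr p) * D + B)"
    by (simp add: distrib_left add_mono)
  moreover have "ennreal (2 powr (p - 1) * real ?T) \<le> ennreal (6 powr (p - 1) * real ?T)"
    using assms by (intro ennreal_leI mult_right_mono powr_mono2) auto
  ultimately have "ennreal (2 powr (p - 1) * real ?T) * (ennreal (2 * R powr p) * (of_nat ?T * D) + B) \<le>
      ennreal (6 powr (p - 1) * real ?T) * (of_nat (2 ^ ?T) * (ennreal (R powr p) * D + B))"
    by (intro mult_mono) auto
  also have "\<dots> = ennreal (6 powr (p - 1) * real ?T * 2 ^ ?T) * (ennreal (R powr p) * D + B)"
    by (simp add: ennreal_of_nat_eq_real_of_nat mult.assoc[symmetric] ennreal_mult' flip: ennreal_power)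
  finally show ?thesis .
qed

text \<open>The infimum is bounded by the cost of the stepwise coupling. Each tail involves one path
  only and therefore reduces to an integral against a marginal; the joint law enters only through
  the probability that the paths differ.\<close>

lemma adapted_wasserstein_density_le:
  fixes g h :: "('d::finite, 't::{finite, linorder}) path_space \<Rightarrow> ennreal"
  assumes p: "1 \<le> p" and R: "0 < R"
    and g[measurable]: "g \<in> borel_measurable borel" and h[measurable]: "h \<in> borel_measurable borel"
    and one: "(\<integral>\<^sup>+ x. g x \<partial>lborel) = 1" "(\<integral>\<^sup>+ x. h x \<partial>lborel) = 1"
  shows "epowr (adapted_wasserstein p (density lborel g) (density lborel h)) p \<le>
    ennreal (6 powr (p - 1) * real CARD('t) * 2 ^ CARD('t)) *
    (ennreal (R powr p) * ((\<integral>\<^sup>+ x. g x - h x \<partial>lborel) + (\<integral>\<^sup>+ x. h x - g x \<partial>lborel)) +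
     ((\<integral>\<^sup>+ x\<in>{x. R \<le> norm x}. ennreal (norm x powr p) \<partial>density lborel g) +
      (\<integral>\<^sup>+ x\<in>{x. R \<le> norm x}. ennreal (norm x powr p) \<partial>density lborel h)))"
proof -
  obtain \<pi> where "stepwise_coupling g h \<pi>"
    using stepwise_coupling_exists[OF g h one] by blast
  then interpret stepwise_coupling g h \<pi> .
  define tail where "tail x = ennreal (norm x powr p) * indicator {x. R \<le> norm x} x" for x :: "('d, 't) path_space"
  have [measurable]: "tail \<in> borel_measurable borel"
    unfolding tail_def by measurable
  have "closed {z :: ('d, 't) path_space \<times> ('d, 't) path_space. fst z = snd z}"
    by (intro closed_Collect_eq continuous_intros)
  then have "- {z :: ('d, 't) path_space \<times> ('d, 't) path_space. fst z = snd z} \<in> sets borel"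
    by (intro borel_open) (simp add: open_Compl)
  then have [measurable]: "{z :: ('d, 't) path_space \<times> ('d, 't) path_space. fst z \<noteq> snd z} \<in> sets \<pi>"
    by (simp add: sets_borel Collect_neg_eq)
  have marg: "(\<integral>\<^sup>+ z. tail (fst z) \<partial>\<pi>) = (\<integral>\<^sup>+ x. tail x \<partial>density lborel g)"
    "(\<integral>\<^sup>+ z. tail (snd z) \<partial>\<pi>) = (\<integral>\<^sup>+ x. tail x \<partial>density lborel h)"
    by (simp_all add: nn_integral_marginal nn_integral_density)
  have "epowr (adapted_wasserstein p (density lborel g) (density lborel h)) p \<le>
      (\<integral>\<^sup>+ z. ennreal (\<Sum>t\<in>UNIV. norm (fst z $ t - snd z $ t) powr p) \<partial>\<pi>)"
    using p INF_lower[OF in_bicausal_couplings]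
    by (simp add: adapted_wasserstein_def epowr_epowr_inverse case_prod_beta')
  also have "\<dots> \<le> (\<integral>\<^sup>+ z. ennreal (2 powr (p - 1) * real CARD('t)) *
      (ennreal (2 * R powr p) * indicator {z. fst z \<noteq> snd z} z + (tail (fst z) + tail (snd z))) \<partial>\<pi>)"
    using path_cost_le[OF p R, where 't = 't and 'd = 'd]
    by (intro nn_integral_mono) (auto simp: tail_def)
  also have "\<dots> = ennreal (2 powr (p - 1) * real CARD('t)) *
      (ennreal (2 * R powr p) * (\<integral>\<^sup>+ z. indicator {z. fst z \<noteq> snd z} z \<partial>\<pi>) +
       ((\<integral>\<^sup>+ x. tail x \<partial>density lborel g) + (\<integral>\<^sup>+ x. tail x \<partial>density lborel h)))"
    by (simp add: nn_integral_cmult nn_integral_add marg)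
  also have "\<dots> \<le> ennreal (2 powr (p - 1) * real CARD('t)) *
      (ennreal (2 * R powr p) * (of_nat CARD('t) * ((\<integral>\<^sup>+ x. g x - h x \<partial>lborel) + (\<integral>\<^sup>+ x. h x - g x \<partial>lborel))) +
       ((\<integral>\<^sup>+ x. tail x \<partial>density lborel g) + (\<integral>\<^sup>+ x. tail x \<partial>density lborel h)))"
    by (intro mult_left_mono add_right_mono nn_integral_neq_le) auto
  also have "\<dots> \<le> ennreal (6 powr (p - 1) * real CARD('t) * 2 ^ CARD('t)) *
    (ennreal (R powr p) * ((\<integral>\<^sup>+ x. g x - h x \<partial>lborel) + (\<integral>\<^sup>+ x. h x - g x \<partial>lborel)) +
       ((\<integral>\<^sup>+ x. tail x \<partial>density lborel g) + (\<integral>\<^sup>+ x. tail x \<partial>density lborel h)))"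
    by (rule constant_le[OF p R])
  finally show ?thesis
    by (simp add: tail_def)
qed

theorem theorem22:
  fixes p R \<sigma> :: real
    and \<xi> \<mu> \<nu> :: "('d::finite, 't::{finite, linorder}) path_space measure"
    and f :: "('d, 't) path_space \<Rightarrow> real"
    and grad_f :: "('d, 't) path_space \<Rightarrow> ('d, 't) path_space"
  assumes "1 \<le> p"
    and "\<xi> \<in> prob_measures_p p"
    and "\<And>x. 0 \<le> f x"
    and "\<xi> = density lborel (\<lambda>x. ennreal (f x))"
    and "\<And>x. GDERIV f x :> grad_f x"
    and "continuous_on UNIV grad_f"
    and "integrable lborel grad_f"
    and "{s. fourier f s = 0} \<in> null_sets lborel"
    and "\<mu> \<in> prob_measures_p p"
    and "\<nu> \<in> prob_measures_p p"
    and "0 < R"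
    and "0 < \<sigma>"
  shows "epowr (smoothed_adapted_wasserstein p \<xi> \<sigma> \<mu> \<nu>) p \<le>
    ennreal (6 powr (p - 1) * real CARD('t) * 2 ^ CARD('t)) *
    (ennreal (R powr p) * ennreal (LINT x|lborel. norm (grad_f x)) * (wasserstein 1 \<mu> \<nu> / ennreal \<sigma>) +
     ((\<integral>\<^sup>+ x\<in>{x. R \<le> norm x}. ennreal (norm x powr p) \<partial>smoothed \<xi> \<sigma> \<mu>) +
      (\<integral>\<^sup>+ x\<in>{x. R \<le> norm x}. ennreal (norm x powr p) \<partial>smoothed \<xi> \<sigma> \<nu>)))"
proof -
  have \<xi>: "prob_space \<xi>" and \<mu>: "prob_space \<mu>" "sets \<mu> = sets borel" and \<nu>: "prob_space \<nu>" "sets \<nu> = sets borel"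
    using assms by (auto simp: prob_measures_p_def)
  have "continuous_on UNIV f"
    using assms(5) by (intro continuous_at_imp_continuous_on ballI has_derivative_continuous) (auto simp: gderiv_def)
  then have f[measurable]: "f \<in> borel_measurable borel"
    by (rule borel_measurable_continuous_onI)
  define g where "g = (\<lambda>\<mu> w. \<integral>\<^sup>+ y. ennreal (noise_kernel f \<sigma> y w) \<partial>\<mu>)"
  have smooth: "smoothed \<xi> \<sigma> \<mu>' = density lborel (g \<mu>')" "g \<mu>' \<in> borel_measurable borel"
      "(\<integral>\<^sup>+ w. g \<mu>' w \<partial>lborel) = 1"
    if \<mu>': "prob_space \<mu>'" "sets \<mu>' = sets borel" for \<mu>'
  proof -
    interpret \<mu>': prob_space \<mu>' by fact
    note [measurable_cong] = \<mu>'(2)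
    show eq: "smoothed \<xi> \<sigma> \<mu>' = density lborel (g \<mu>')"
      unfolding g_def by (rule smoothed_eq_density[OF \<xi> assms(4) f \<mu>' assms(12)])
    show [measurable]: "g \<mu>' \<in> borel_measurable borel"
      unfolding g_def by measurable
    have [measurable_cong]: "sets (scaled_noise \<xi> \<sigma>) = sets borel"
      by (simp add: scaled_noise_def)
    interpret N: prob_space "scaled_noise \<xi> \<sigma>"
      unfolding scaled_noise_def by (rule prob_space.prob_space_distr[OF \<xi>]) (simp add: assms(4))
    interpret pair_prob_space \<mu>' "scaled_noise \<xi> \<sigma>" ..
    have "prob_space (smoothed \<xi> \<sigma> \<mu>')"
      unfolding smoothed_def convolution_def by (rule prob_space_distr) measurable
    then have "emeasure (smoothed \<xi> \<sigma> \<mu>') UNIV = 1"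
      using prob_space.emeasure_space_1 by (fastforce simp: smoothed_def)
    then show "(\<integral>\<^sup>+ w. g \<mu>' w \<partial>lborel) = 1"
      by (simp add: eq emeasure_density)
  qed
  note g\<mu> = smooth[OF \<mu>] and g\<nu> = smooth[OF \<nu>]
  define G where "G = (LINT x|lborel. norm (grad_f x))"
  have G: "(\<integral>\<^sup>+ z. ennreal (norm (grad_f z)) \<partial>lborel) = ennreal G"
    unfolding G_def using assms(7) by (intro nn_integral_eq_integral) auto
  \<comment> \<open>Here \<mu> and \<nu> are coupled arbitrarily: the estimate of the densities
    knows nothing of time, and causality concerns only the coupling of the smoothed laws.\<close>
  have "(\<integral>\<^sup>+ w. g \<mu> w - g \<nu> w \<partial>lborel) + (\<integral>\<^sup>+ w. g \<nu> w - g \<mu> w \<partial>lborel) \<le> ennreal G * (wasserstein 1 \<mu> \<nu> / ennreal \<sigma>)"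
  proof (rule le_mult_wasserstein_1)
    show "couplings \<mu> \<nu> \<noteq> {}"
      using couplings_nonempty[OF \<mu> \<nu>] by blast
    show "0 \<le> G"
      unfolding G_def by simp
    show "(\<integral>\<^sup>+ w. g \<mu> w - g \<nu> w \<partial>lborel) + (\<integral>\<^sup>+ w. g \<nu> w - g \<mu> w \<partial>lborel) \<le>
        ennreal G * ((\<integral>\<^sup>+ z. ennreal (norm (fst z - snd z)) \<partial>\<pi>) / ennreal \<sigma>)"
      if "\<pi> \<in> couplings \<mu> \<nu>" for \<pi>
      using total_variation_smoothed_le[OF assms(5,6) f assms(3,12) that] g\<mu>(3) g\<nu>(3)
      unfolding G g_def by simp
  qed (rule assms(12))
  then have "ennreal (R powr p) * ((\<integral>\<^sup>+ w. g \<mu> w - g \<nu> w \<partial>lborel) + (\<integral>\<^sup>+ w. g \<nu> w - g \<mu> w \<partial>lborel)) \<le>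
      ennreal (R powr p) * ennreal G * (wasserstein 1 \<mu> \<nu> / ennreal \<sigma>)"
    unfolding mult.assoc by (rule mult_left_mono) simp
  then show ?thesis
    unfolding smoothed_adapted_wasserstein_def g\<mu>(1) g\<nu>(1) G_def[symmetric]
    by (rule order_trans[OF adapted_wasserstein_density_le[OF assms(1,11) g\<mu>(2) g\<nu>(2) g\<mu>(3) g\<nu>(3)]
          mult_left_mono[OF add_right_mono]]) simp
qed

end
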